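(* Let $q$ be a prime power, $m\ge1$, $1\le k\le q-1$. Let $\Pi_\infty=\{\mathbf P\in\mathbb P^m: P_0=0\}$, identified with $\mathbb P^{m-1}$ by deleting the zeroth coordinate, and identify $\mathbb A^m=\mathbb F_q^m$ with $\mathbb P^m\setminus\Pi_\infty$ via $(a_1,\dots,a_m)\mapsto(1:a_1:\dots:a_m)$. Let $$\mathcal S=\{c_{|\mathbb A^m} : c\in\mathrm{PLift}_q(m,k),\ c_{\mathbf P}=0\ \forall\mathbf P\in\Pi_\infty\},\qquad \mathcal P=\{c_{|\Pi_\infty}: c\in\mathrm{PLift}_q(m,k)\}.$$ Then $\mathcal S=\mathrm{Lift}_q(m,k-1)$ and, if $m\ge2$, $\mathcal P=\mathrm{PLift}_q(m-1,k)$.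
   Context: Projective side. $\mathbb P^m=(\mathbb F_q^{m+1}\setminus\{0\})/\mathbb F_q^\times$; the standard representative of a point is the one whose leftmost non-zero coordinate is $1$. $\mathbb F_q[\mathbf X]^H_v$ is the space of homogeneous polynomials of degree $v$ in $X_0,\dots,X_m$ (together with $0$), and $\mathrm{ev}_{\mathbb P^m}(f)=(f(\mathbf P))_{\mathbf P\in\mathbb P^m}$, evaluating at standard representatives. $\mathrm{PRS}_q(k)=\{\mathrm{ev}_{\mathbb P^1}(g): g\in\mathbb F_q[S,T]^H_k\}$. $\mathrm{Emb}_{\mathbb P}(m)$ is the set of injective $\mathbb F_q$-linear maps $L:\mathbb F_q^2\to\mathbb F_q^{m+1}$, and $f\circ L=f(L(S,T))$. For $m\ge1$, $1\le k\le q-1$ and $v=k+(m-1)(q-1)$, $$\mathrm{PLift}_q(m,k)=\{\mathrm{ev}_{\mathbb P^m}(f): f\in\mathbb F_q[\mathbf X]^H_v,\ \forall L\in\mathrm{Emb}_{\mathbb P}(m),\ \mathrm{ev}_{\mathbb P^1}(f\circ L)\in\mathrm{PRS}_q(k)\}.$$ Affine side. For $f\in\mathbb F_q[X_1,\dots,X_m]$, $\mathrm{ev}_{\mathbb A^m}(f)=(f(\mathbf x))_{\mathbf x\in\mathbb F_q^m}$. $\mathrm{RS}_q(k)=\{\mathrm{ev}_{\mathbb A^1}(g): g\in\mathbb F_q[T],\deg g\le k\}$. $\mathrm{Emb}_{\mathbb A}(m)$ is the set of linear maps $L^*=(L_1,\dots,L_m):\mathbb F_q^2\to\mathbb F_q^m$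 for which some $L_0$ makes $(L_0,\dots,L_m)$ an element of $\mathrm{Emb}_{\mathbb P}(m)$; $f\circ L^*$ is the univariate polynomial $f(L^*(1,T))$. For $m\ge1$, $0\le k\le q-2$, $$\mathrm{Lift}_q(m,k)=\{\mathrm{ev}_{\mathbb A^m}(f): f\in\mathbb F_q[X_1,\dots,X_m],\ \forall L\in\mathrm{Emb}_{\mathbb A}(m),\ \mathrm{ev}_{\mathbb A^1}(f\circ L)\in\mathrm{RS}_q(k)\}.$$ *)

theory Defs
  imports
    "HOL-Library.Poly_Mapping"
    "HOL-Library.FuncSet"
    "HOL-Library.Cardinality"
    "HOL-Computational_Algebra.Polynomial"
    "Jordan_Normal_Form.Matrix"
begin

text \<open>
  A polynomial is a finitely supported map from exponent vectors to coefficients, multiplied by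
  convolution. Variables are numbered from 0, so \<open>F[X\<^sub>0, \<dots>, X\<^sub>m]\<close> is \<open>polys (Suc m)\<close>, and the affine
  ring \<open>F[X\<^sub>1, \<dots>, X\<^sub>m]\<close> is \<open>polys m\<close>, with \<open>X\<^sub>i\<^sub>+\<^sub>1\<close> being variable number \<open>i\<close>
  and coordinate number \<open>i\<close> of \<open>carrier_vec m\<close>.
\<close>

type_synonym 'a mpoly = "(nat \<Rightarrow>\<^sub>0 nat) \<Rightarrow>\<^sub>0 'a"

definition polys :: "nat \<Rightarrow> 'a::zero mpoly set" where
  "polys n = {f. \<forall>e \<in> Poly_Mapping.keys f. Poly_Mapping.keys e \<subseteq> {..<n}}"

definition homogeneous_polys :: "nat \<Rightarrow> nat \<Rightarrow> 'a::zero mpoly set" where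
  "homogeneous_polys n v =
     {f \<in> polys n. \<forall>e \<in> Poly_Mapping.keys f. (\<Sum>i \<in> Poly_Mapping.keys e. Poly_Mapping.lookup e i) = v}"

definition mpoly_Const :: "'a::zero \<Rightarrow> 'a mpoly" where
  "mpoly_Const c = Poly_Mapping.single 0 c"

definition mpoly_Var :: "nat \<Rightarrow> 'a::zero_neq_one mpoly" where
  "mpoly_Var i = Poly_Mapping.single (Poly_Mapping.single i 1) 1"

text \<open>Substitution of \<open>x i\<close> for variable \<open>i\<close>, with coefficients mapped to the target ring by \<open>\<phi>\<close>.\<close>

definition subst_mpoly :: "('a::zero \<Rightarrow> 'b::comm_semiring_1) \<Rightarrow> (nat \<Rightarrow> 'b) \<Rightarrow> 'a mpoly \<Rightarrow> 'b" where
  "subst_mpoly \<phi> x f =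
     (\<Sum>e \<in> Poly_Mapping.keys f.
        \<phi> (Poly_Mapping.lookup f e) * (\<Prod>i \<in> Poly_Mapping.keys e. x i ^ Poly_Mapping.lookup e i))"

definition eval_mpoly :: "'a::comm_semiring_1 vec \<Rightarrow> 'a mpoly \<Rightarrow> 'a" where
  "eval_mpoly x f = subst_mpoly (\<lambda>c. c) (\<lambda>i. x $ i) f"

definition proj_rel :: "nat \<Rightarrow> ('a::field vec \<times> 'a vec) set" where
  "proj_rel m = {(x, y). x \<in> carrier_vec (Suc m) - {0\<^sub>v (Suc m)} \<and> y \<in> carrier_vec (Suc m) - {0\<^sub>v (Suc m)} \<and>
                         (\<exists>c. c \<noteq> 0 \<and> y = c \<cdot>\<^sub>v x)}"

definition proj_space :: "nat \<Rightarrow> 'a::field vec set set" where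
  "proj_space m = (carrier_vec (Suc m) - {0\<^sub>v (Suc m)}) // proj_rel m"

definition is_standard :: "'a::field vec \<Rightarrow> bool" where
  "is_standard x \<longleftrightarrow> (\<exists>i < dim_vec x. x $ i = 1 \<and> (\<forall>j < i. x $ j = 0))"

definition standard_rep :: "'a::field vec set \<Rightarrow> 'a vec" where
  "standard_rep P = (THE x. x \<in> P \<and> is_standard x)"

definition hyperplane_at_infinity :: "nat \<Rightarrow> 'a::field vec set set" where
  "hyperplane_at_infinity m = {P \<in> proj_space m. \<forall>x \<in> P. x $ 0 = 0}"

text \<open>Codewords are indexed by the points themselves; they are \<open>undefined\<close> off the index set.\<close>

definition ev_proj :: "nat \<Rightarrow> 'a::field mpoly \<Rightarrow> 'a vec set \<Rightarrow> 'a" where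
  "ev_proj m f = (\<lambda>P \<in> proj_space m. eval_mpoly (standard_rep P) f)"

definition ev_aff :: "nat \<Rightarrow> 'a::field mpoly \<Rightarrow> 'a vec \<Rightarrow> 'a" where
  "ev_aff m f = (\<lambda>a \<in> carrier_vec m. eval_mpoly a f)"

text \<open>
  Restriction of a codeword on \<open>P\<^sup>m\<close> to the affine space, where \<open>a\<close> is identified with \<open>(1 : a)\<close>,
  and to the hyperplane at infinity. In the latter, the point of the hyperplane that becomes \<open>Q\<close>
  on deleting the zeroth coordinate is \<open>vCons 0 ` Q\<close>.
\<close>

definition restrict_aff :: "nat \<Rightarrow> ('a::field vec set \<Rightarrow> 'a) \<Rightarrow> 'a vec \<Rightarrow> 'a" where
  "restrict_aff m c = (\<lambda>a \<in> carrier_vec m. c (proj_rel m `` {vCons 1 a}))"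

definition restrict_inf :: "nat \<Rightarrow> ('a::field vec set \<Rightarrow> 'a) \<Rightarrow> 'a vec set \<Rightarrow> 'a" where
  "restrict_inf m c = (\<lambda>Q \<in> proj_space (m - 1). c (vCons 0 ` Q))"

definition linear_maps :: "nat \<Rightarrow> nat \<Rightarrow> ('a::field vec \<Rightarrow> 'a vec) set" where
  "linear_maps n d =
     {L \<in> carrier_vec n \<rightarrow>\<^sub>E carrier_vec d.
        (\<forall>x \<in> carrier_vec n. \<forall>y \<in> carrier_vec n. L (x + y) = L x + L y) \<and>
        (\<forall>c. \<forall>x \<in> carrier_vec n. L (c \<cdot>\<^sub>v x) = c \<cdot>\<^sub>v L x)}"

definition emb_proj :: "nat \<Rightarrow> ('a::field vec \<Rightarrow> 'a vec) set" where
  "emb_proj m = {L \<in> linear_maps 2 (Suc m). inj_on L (carrier_vec 2)}"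

definition emb_aff :: "nat \<Rightarrow> ('a::field vec \<Rightarrow> 'a vec) set" where
  "emb_aff m = {L \<in> linear_maps 2 m. \<exists>L0. (\<lambda>x \<in> carrier_vec 2. vCons (L0 x) (L x)) \<in> emb_proj m}"

text \<open>
  \<open>compose_proj\<close> is \<open>f(L(S, T))\<close> with \<open>S\<close>, \<open>T\<close> the variables 0 and 1; \<open>compose_aff\<close> is \<open>f(L(1, T))\<close>.
  The coefficients of the \<open>i\<close>-th linear form of \<open>L\<close> are read off from the two unit vectors.
\<close>

definition compose_proj :: "'a::field mpoly \<Rightarrow> ('a vec \<Rightarrow> 'a vec) \<Rightarrow> 'a mpoly" where
  "compose_proj f L =
     subst_mpoly mpoly_Const
       (\<lambda>i. mpoly_Const (L (unit_vec 2 0) $ i) * mpoly_Var 0 +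
            mpoly_Const (L (unit_vec 2 1) $ i) * mpoly_Var 1) f"

definition compose_aff :: "'a::field mpoly \<Rightarrow> ('a vec \<Rightarrow> 'a vec) \<Rightarrow> 'a poly" where
  "compose_aff f L =
     subst_mpoly (\<lambda>c. [:c:]) (\<lambda>i. [:L (unit_vec 2 0) $ i, L (unit_vec 2 1) $ i:]) f"

definition PRS :: "nat \<Rightarrow> ('a::field vec set \<Rightarrow> 'a) set" where
  "PRS k = {ev_proj 1 g |g. g \<in> homogeneous_polys 2 k}"

definition PLift :: "nat \<Rightarrow> nat \<Rightarrow> ('a::{field,finite} vec set \<Rightarrow> 'a) set" where
  "PLift m k =
     {ev_proj m f |f. f \<in> homogeneous_polys (Suc m) (k + (m - 1) * (CARD('a) - 1)) \<and>
                      (\<forall>L \<in> emb_proj m. ev_proj 1 (compose_proj f L) \<in> PRS k)}"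

text \<open>The evaluation of \<open>g \<in> F[T]\<close> on the affine line is the function \<open>poly g\<close>.\<close>

definition RS :: "nat \<Rightarrow> ('a::field \<Rightarrow> 'a) set" where
  "RS k = {poly g |g. degree g \<le> k}"

definition Lift :: "nat \<Rightarrow> nat \<Rightarrow> ('a::{field,finite} vec \<Rightarrow> 'a) set" where
  "Lift m k = {ev_aff m f |f. f \<in> polys m \<and> (\<forall>L \<in> emb_aff m. poly (compose_aff f L) \<in> RS k)}"

end

theory Submission
  imports Defs
begin

text \<open>
  The key point is that \<open>PLift n k\<close> consists exactly of the evaluations of the functions \<open>G\<close> on
  \<open>F\<^sup>n\<^sup>+\<^sup>1\<close> whose restriction to every linear plane is a binary form of degree \<open>k\<close>: the requirement that
  \<open>G\<close> come from a homogeneous polynomial of degree \<open>v = k + (n - 1)(q - 1)\<close> is automatic. Indeed, a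
  coefficient of the reduced polynomial of \<open>G\<close> at a monomial of degree \<open>d\<close> is a sum
  \<open>\<Sum>a. G a * P a\<close> with \<open>deg P \<le> (n + 1)(q - 1) - d\<close>. If \<open>d > v\<close>, then \<open>G P\<close> has degree less than
  \<open>2(q - 1)\<close> on each plane, so its sum over each plane vanishes, and hence so does the coefficient.
  Homogeneity forces \<open>d \<equiv> k\<close> modulo \<open>q - 1\<close>, and \<open>x\<^sup>q = x\<close> then raises every monomial to degree \<open>v\<close>.

  With this description, the shortening is the extension by zero of \<open>x\<^sub>0\<^sup>k h(x/x\<^sub>0)\<close>, and surjectivity of the
  restriction to infinity holds because the cone \<open>(x\<^sub>0, x) \<mapsto> G x\<close> over \<open>G\<close> is again such a function.
\<close>

section \<open>Powers in a finite field\<close>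

text \<open>Multiplication by \<open>x\<close> permutes the nonzero elements, so the factor x^(q-1)
  does not change their nonzero product. Here and below q is \<open>CARD('a)\<close>.\<close>

lemma finite_field_power_card_minus_one:
  fixes x :: "'a::{field,finite}"
  assumes "x \<noteq> 0"
  shows "x ^ (CARD('a) - 1) = 1"
proof -
  have bij: "bij_betw ((*) x) (UNIV - {0}) (UNIV - {0})"
    by (rule bij_betwI[where g = "\<lambda>y. y / x"]) (use assms in auto)
  have "(\<Prod>y\<in>UNIV - {0::'a}. y) = (\<Prod>y\<in>UNIV - {0}. x * y)"
    using prod.reindex_bij_betw[OF bij, of "\<lambda>y. y"] by simp
  also have "\<dots> = x ^ (CARD('a) - 1) * (\<Prod>y\<in>UNIV - {0}. y)"
    by (simp add: prod.distrib card_Diff_singleton)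
  finally show ?thesis by (simp add: prod_zero_iff)
qed

text \<open>Translation by 1 permutes the field, yet changes the sum of all its elements by
  q.\<close>

lemma of_nat_card_UNIV_eq_0: "of_nat CARD('a::{field,finite}) = (0::'a)"
proof -
  have bij: "bij_betw ((+) (1::'a)) UNIV UNIV"
    by (rule bij_betwI[where g = "\<lambda>y. y - 1"]) auto
  have "(\<Sum>y\<in>UNIV. y) = (\<Sum>y\<in>UNIV. 1 + (y::'a))"
    using sum.reindex_bij_betw[OF bij, of "\<lambda>y. y"] by simp
  then show ?thesis by (simp add: sum.distrib)
qed

lemma CARD_field_ge_2: "2 \<le> CARD('a::{field,finite})"
  using card_mono[of UNIV "{0, 1 :: 'a}"] by simp

text \<open>Positivity of \<open>n\<close> covers \<open>x = 0\<close>, where the exponents 0 and q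
  - 1 give different values.\<close>

lemma finite_field_power_add_card:
  fixes x :: "'a::{field,finite}"
  assumes "0 < n"
  shows "x ^ (n + j * (CARD('a) - 1)) = x ^ n"
  using assms
  using finite_field_power_card_minus_one[of x]
  by (cases "x = 0") (simp_all add: power_add power_mult mult.commute[of j])

text \<open>Otherwise all q - 1 nonzero elements would be roots of X^n - 1, whose degree is smaller
  than that.\<close>

lemma finite_field_power_neq_1:
  assumes "0 < n" "n < CARD('a::{field,finite}) - 1"
  shows "\<exists>x::'a. x \<noteq> 0 \<and> x ^ n \<noteq> 1"
proof (rule ccontr)
  assume *: "\<not> ?thesis"
  let ?p = "monom 1 n - 1 :: 'a poly"
  have "coeff ?p n = 1" using assms by simp
  then have nz: "?p \<noteq> 0" by (metis coeff_0 zero_neq_one)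
  have "UNIV - {0} \<subseteq> {x. poly ?p x = 0}"
    using * by (auto simp: poly_monom)
  then have "CARD('a) - 1 \<le> card {x. poly ?p x = 0}"
    using card_mono[of "{x. poly ?p x = 0}" "UNIV - {0}"] by simp
  also have "\<dots> \<le> degree ?p"
    by (rule card_poly_roots_bound[OF nz])
  also have "\<dots> \<le> n"
    by (intro degree_diff_le) (simp_all add: degree_monom_le)
  finally show False using assms by simp
qed

text \<open>The difference of the exponents, reduced modulo q - 1, sends every nonzero element to 1;
  being less than q - 1, it can only be 0.\<close>

lemma finite_field_power_eq_imp_mod_eq:
  assumes "\<And>x::'a::{field,finite}. x \<noteq> 0 \<Longrightarrow> x ^ i = x ^ j"
  shows "i mod (CARD('a) - 1) = j mod (CARD('a) - 1)"
  using assms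
proof (induction i j rule: linorder_wlog)
  case (le i j)
  let ?q = "CARD('a) - 1" and ?d = "(j - i) mod (CARD('a) - 1)"
  have "x ^ ?d = 1" if "x \<noteq> 0" for x :: 'a
  proof -
    have "x ^ i * x ^ (j - i) = x ^ j"
      using le.hyps by (simp flip: power_add)
    then have "x ^ i * x ^ (j - i) = x ^ i"
      using le.prems[OF that] by simp
    then have "x ^ (j - i) = 1" using that by simp
    moreover have "x ^ (j - i) = x ^ (?q * ((j - i) div ?q) + ?d)" by simp
    ultimately show ?thesis
      unfolding power_add power_mult finite_field_power_card_minus_one[OF that] by simp
  qed
  moreover have "?d < ?q" using CARD_field_ge_2[where 'a='a] by simp
  ultimately have "?d = 0" using finite_field_power_neq_1[of ?d, where 'a='a] by blast
  then show ?case using le by (metis mod_eq_dvd_iff_nat mod_eq_0_iff_dvd)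
next
  case (sym i j)
  then show ?case by metis
qed

text \<open>Substituting \<open>u * x\<close> for \<open>x\<close> multiplies the sum by u^n, and
  some nonzero \<open>u\<close> has u^n different from 1. For \<open>n = 0\<close> the sum is q,
  since 0^0 = 1.\<close>

lemma finite_field_power_sum_eq_0:
  assumes "n < CARD('a::{field,finite}) - 1"
  shows "(\<Sum>x\<in>UNIV. (x::'a) ^ n) = 0"
proof (cases "n = 0")
  case True
  then show ?thesis by (simp add: of_nat_card_UNIV_eq_0)
next
  case False
  then obtain u :: 'a where u: "u \<noteq> 0" "u ^ n \<noteq> 1"
    using finite_field_power_neq_1 assms by blast
  have bij: "bij_betw ((*) u) UNIV UNIV"
    by (rule bij_betwI[where g = "\<lambda>y. y / u"]) (use u in auto)
  have "(\<Sum>x\<in>UNIV. x ^ n) = (\<Sum>x\<in>UNIV. (u * x) ^ n)"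
    using sum.reindex_bij_betw[OF bij, of "\<lambda>y. y ^ n"] by simp
  also have "\<dots> = u ^ n * (\<Sum>x\<in>UNIV. x ^ n)"
    by (simp add: power_mult_distrib sum_distrib_left)
  finally show ?thesis using u by (metis mult_cancel_right1)
qed

text \<open>The sum is the quotient of x^q - a^q by x - a. As y^q = y, it is 1 for distinct
  arguments; for equal ones it consists of q equal terms.\<close>

lemma finite_field_delta:
  fixes x a :: "'a::{field,finite}"
  shows "1 - (\<Sum>j<CARD('a). x ^ j * a ^ (CARD('a) - 1 - j)) = (if x = a then 1 else 0)"
proof -
  let ?S = "\<Sum>j<CARD('a). x ^ j * a ^ (CARD('a) - 1 - j)"
  have fermat: "y ^ CARD('a) = y" for y :: 'a
    using finite_field_power_add_card[of 1 y 1] CARD_field_ge_2[where 'a='a] by simp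
  have "?S = 0" if "x = a"
  proof -
    have "?S = (\<Sum>j<CARD('a). a ^ (CARD('a) - 1))"
      by (rule sum.cong) (auto simp: that simp flip: power_add)
    then show ?thesis by (simp add: of_nat_card_UNIV_eq_0)
  qed
  moreover have "?S = 1" if "x \<noteq> a"
  proof -
    have "x ^ CARD('a) - a ^ CARD('a) = (x - a) * (\<Sum>j<CARD('a). a ^ (CARD('a) - Suc j) * x ^ j)"
      by (rule power_diff_sumr2)
    then have "x - a = (x - a) * ?S"
      by (simp add: fermat mult.commute)
    then show ?thesis using that by simp
  qed
  ultimately show ?thesis by auto
qed

section \<open>Bivariate polynomial functions\<close>

text \<open>
  Binary forms of degree \<open>k\<close> are the case \<open>D = {k}\<close>, and polynomials of degree at most \<open>d\<close> the
  case \<open>D = {..d}\<close>; both as functions rather than formal polynomials.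
\<close>

inductive bivariate :: "nat set \<Rightarrow> ('a::comm_ring_1 \<Rightarrow> 'a \<Rightarrow> 'a) \<Rightarrow> bool" for D where
  zero: "bivariate D (\<lambda>s t. 0)"
| monomial: "i + j \<in> D \<Longrightarrow> bivariate D (\<lambda>s t. c * s ^ i * t ^ j)"
| add: "bivariate D f \<Longrightarrow> bivariate D g \<Longrightarrow> bivariate D (\<lambda>s t. f s t + g s t)"

lemma bivariate_mono: "bivariate D f \<Longrightarrow> D \<subseteq> E \<Longrightarrow> bivariate E f"
  by (induction rule: bivariate.induct) (auto intro: bivariate.intros)

lemma bivariate_mult_monomial:
  assumes "bivariate E g" and "\<And>b. b \<in> E \<Longrightarrow> i + j + b \<in> C"
  shows "bivariate C (\<lambda>s t. (c * s ^ i * t ^ j) * g s t)"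
  using assms(1)
proof induction
  case zero
  show ?case using bivariate.zero by simp
next
  case (monomial k l d)
  have "(\<lambda>s t. (c * s ^ i * t ^ j) * (d * s ^ k * t ^ l)) = (\<lambda>s t. (c * d) * s ^ (i + k) * t ^ (j + l))"
    by (simp add: fun_eq_iff power_add mult_ac)
  then show ?case
    using assms(2)[OF monomial] bivariate.monomial[of "i + k" "j + l" C "c * d"]
    by (simp add: add_ac)
next
  case (add f g)
  then show ?case using bivariate.add by (fastforce simp: distrib_left)
qed

lemma bivariate_mult:
  assumes "bivariate D f" "bivariate E g" and "\<And>a b. a \<in> D \<Longrightarrow> b \<in> E \<Longrightarrow> a + b \<in> C"
  shows "bivariate C (\<lambda>s t. f s t * g s t)"
  using assms(1)
proof induction
  case zero
  show ?case using bivariate.zero by simp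
next
  case (monomial i j c)
  show ?case by (rule bivariate_mult_monomial[OF assms(2)]) (use assms(3) monomial in auto)
next
  case (add f h)
  then show ?case using bivariate.add by (fastforce simp: distrib_right)
qed

lemma bivariate_const: "0 \<in> D \<Longrightarrow> bivariate D (\<lambda>s t. c)"
  using bivariate.monomial[of 0 0 D c] by simp

lemma bivariate_linear: "1 \<in> D \<Longrightarrow> bivariate D (\<lambda>s t. s * a + t * b)"
  using bivariate.add[OF bivariate.monomial[of 1 0 D a] bivariate.monomial[of 0 1 D b]]
  by (simp add: mult.commute)

lemma bivariate_power:
  "bivariate {d} f \<Longrightarrow> bivariate {n * d} (\<lambda>s t. f s t ^ n)"
proof (induction n)
  case 0
  show ?case using bivariate_const[of "{0}" 1] by simp
next
  case (Suc n)
  show ?case unfolding power_Suc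
    by (rule bivariate_mult[OF Suc.prems Suc.IH[OF Suc.prems]]) auto
qed

lemma bivariate_prod:
  assumes "finite I" and "\<And>i. i \<in> I \<Longrightarrow> bivariate {..d i} (f i)"
  shows "bivariate {..\<Sum>i\<in>I. d i} (\<lambda>s t. \<Prod>i\<in>I. f i s t)"
  using assms
proof (induction I)
  case empty
  show ?case by (simp add: bivariate_const)
next
  case (insert i I)
  then have "bivariate {..d i + (\<Sum>i\<in>I. d i)} (\<lambda>s t. f i s t * (\<Prod>i\<in>I. f i s t))"
    by (intro bivariate_mult[of "{..d i}" _ "{..\<Sum>i\<in>I. d i}"]) auto
  then show ?case using insert by simp
qed

lemma bivariate_subst:
  assumes "bivariate {k} f" "bivariate {1} g" "bivariate {1} h"
  shows "bivariate {k} (\<lambda>s t. f (g s t) (h s t))"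
  using assms(1)
proof induction
  case zero
  show ?case by (rule bivariate.zero)
next
  case (monomial i j c)
  have "bivariate {i} (\<lambda>s t. c * g s t ^ i)"
    by (rule bivariate_mult[OF bivariate_const[of "{0}"] bivariate_power[OF assms(2)]]) auto
  then show ?case
    by (rule bivariate_mult[OF _ bivariate_power[OF assms(3)]]) (use monomial in auto)
next
  case (add u v)
  show ?case by (rule bivariate.add[OF add.IH])
qed

text \<open>In each monomial one of the two exponents is below q - 1, and the power sum in that
  variable vanishes.\<close>

lemma bivariate_sum_eq_0:
  fixes f :: "'a::{field,finite} \<Rightarrow> 'a \<Rightarrow> 'a"
  assumes "bivariate {..<2 * (CARD('a) - 1)} f"
  shows "(\<Sum>s\<in>UNIV. \<Sum>t\<in>UNIV. f s t) = 0"
  using assms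
proof induction
  case (monomial i j c)
  then have "i < CARD('a) - 1 \<or> j < CARD('a) - 1" by auto
  moreover have "(\<Sum>s\<in>UNIV. \<Sum>t\<in>UNIV. c * s ^ i * t ^ j) = c * ((\<Sum>s\<in>UNIV. s ^ i) * (\<Sum>t\<in>UNIV. t ^ j))"
    unfolding sum_product by (simp add: sum_distrib_left mult_ac)
  ultimately show ?case using finite_field_power_sum_eq_0[where 'a='a] by auto
qed (simp_all add: sum.distrib)

text \<open>The value at the point at infinity of the projective line is the top coefficient of the
  dehomogenised polynomial. This turns vanishing at infinity into a drop of the degree.\<close>

lemma bivariate_form_dehomogenize:
  assumes "bivariate {k} f"
  shows "\<exists>p. degree p \<le> k \<and> (\<forall>t. f 1 t = poly p t) \<and> f 0 1 = coeff p k"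
  using assms
proof induction
  case zero
  show ?case by (rule exI[of _ 0]) simp
next
  case (monomial i j c)
  \<comment> \<open>At (0, 1) the monomial is c * 0^i, which is \<open>c\<close> for
    \<open>i = 0\<close>, that is \<open>j = k\<close>, and 0 otherwise.\<close>
  then show ?case
    by (intro exI[of _ "monom c j"])
      (auto simp: poly_monom degree_monom_le power_0_left intro: order_trans[OF degree_monom_le])
next
  case (add f g)
  then obtain p r where "degree p \<le> k \<and> (\<forall>t. f 1 t = poly p t) \<and> f 0 1 = coeff p k"
    "degree r \<le> k \<and> (\<forall>t. g 1 t = poly r t) \<and> g 0 1 = coeff r k" by blast
  then show ?case by (intro exI[of _ "p + r"]) (auto intro: degree_add_le)
qed

lemma bivariate_sum:
  "(\<And>i. i \<in> I \<Longrightarrow> bivariate D (f i)) \<Longrightarrow> bivariate D (\<lambda>s t. \<Sum>i\<in>I. f i s t)"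
  by (induction I rule: infinite_finite_induct) (simp_all add: bivariate.zero bivariate.add)

section \<open>Evaluation of multivariate polynomials\<close>

text \<open>Cancellation can shrink the key set of a sum of polynomials; a common finite index set
  makes the evaluations comparable.\<close>

lemma eval_mpoly_superset:
  assumes "finite A" "Poly_Mapping.keys f \<subseteq> A"
  shows "eval_mpoly x f = (\<Sum>e\<in>A. Poly_Mapping.lookup f e *
    (\<Prod>i\<in>Poly_Mapping.keys e. x $ i ^ Poly_Mapping.lookup e i))"
  unfolding eval_mpoly_def subst_mpoly_def
  by (rule sum.mono_neutral_left) (use assms in \<open>auto simp: in_keys_iff\<close>)

lemma eval_mpoly_0 [simp]: "eval_mpoly x 0 = 0"
  by (simp add: eval_mpoly_def subst_mpoly_def)

lemma eval_mpoly_add: "eval_mpoly x (f + g) = eval_mpoly x f + eval_mpoly x g"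
proof -
  let ?A = "Poly_Mapping.keys f \<union> Poly_Mapping.keys g"
  have "finite ?A" by simp
  then show ?thesis
    using eval_mpoly_superset[of ?A f x] eval_mpoly_superset[of ?A g x]
      eval_mpoly_superset[of ?A "f + g" x] keys_add[of f g]
    by (simp add: lookup_add distrib_right sum.distrib)
qed

lemma eval_mpoly_sum: "eval_mpoly x (\<Sum>i\<in>I. f i) = (\<Sum>i\<in>I. eval_mpoly x (f i))"
  by (induction I rule: infinite_finite_induct) (simp_all add: eval_mpoly_add)

lemma eval_mpoly_single:
  "eval_mpoly x (Poly_Mapping.single e c) =
    c * (\<Prod>i\<in>Poly_Mapping.keys e. x $ i ^ Poly_Mapping.lookup e i)"
  using eval_mpoly_superset[of "{e}" "Poly_Mapping.single e c" x] by simp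

lemma prod_keys_superset:
  fixes x :: "nat \<Rightarrow> 'a::comm_semiring_1"
  assumes "finite A" "Poly_Mapping.keys e \<subseteq> A"
  shows "(\<Prod>i\<in>Poly_Mapping.keys e. x i ^ Poly_Mapping.lookup e i) =
    (\<Prod>i\<in>A. x i ^ Poly_Mapping.lookup e i)"
  by (rule prod.mono_neutral_left) (use assms in \<open>auto simp: in_keys_iff\<close>)

lemma prod_keys_add:
  fixes x :: "nat \<Rightarrow> 'a::comm_semiring_1"
  shows "(\<Prod>i\<in>Poly_Mapping.keys (d + e). x i ^ Poly_Mapping.lookup (d + e) i) =
    (\<Prod>i\<in>Poly_Mapping.keys d. x i ^ Poly_Mapping.lookup d i) *
    (\<Prod>i\<in>Poly_Mapping.keys e. x i ^ Poly_Mapping.lookup e i)"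
proof -
  let ?A = "Poly_Mapping.keys d \<union> Poly_Mapping.keys e"
  have "finite ?A" by simp
  then show ?thesis
    using prod_keys_superset[of ?A d x] prod_keys_superset[of ?A e x]
      prod_keys_superset[of ?A "d + e" x] keys_add[of d e]
    by (simp add: lookup_add power_add prod.distrib)
qed

lemma poly_mapping_eq_sum_single:
  "f = (\<Sum>e\<in>Poly_Mapping.keys f. Poly_Mapping.single e (Poly_Mapping.lookup f e))"
  by (rule poly_mapping_eqI) (simp add: lookup_sum lookup_single when_def in_keys_iff)

lemma eval_mpoly_mult: "eval_mpoly x (f * g) = eval_mpoly x f * eval_mpoly x g"
proof -
  have "f * g = (\<Sum>d\<in>Poly_Mapping.keys f. \<Sum>e\<in>Poly_Mapping.keys g.
      Poly_Mapping.single (d + e) (Poly_Mapping.lookup f d * Poly_Mapping.lookup g e))"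
    by (subst poly_mapping_eq_sum_single[of f], subst poly_mapping_eq_sum_single[of g])
      (simp only: sum_product mult_single)
  then have "eval_mpoly x (f * g) = (\<Sum>d\<in>Poly_Mapping.keys f. \<Sum>e\<in>Poly_Mapping.keys g.
      (Poly_Mapping.lookup f d * (\<Prod>i\<in>Poly_Mapping.keys d. x $ i ^ Poly_Mapping.lookup d i)) *
      (Poly_Mapping.lookup g e * (\<Prod>i\<in>Poly_Mapping.keys e. x $ i ^ Poly_Mapping.lookup e i)))"
    by (simp add: eval_mpoly_sum eval_mpoly_single prod_keys_add mult_ac)
  also have "\<dots> = eval_mpoly x f * eval_mpoly x g"
    by (simp add: eval_mpoly_def subst_mpoly_def sum_product)
  finally show ?thesis .
qed

lemma eval_mpoly_1 [simp]: "eval_mpoly x 1 = 1"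
  using eval_mpoly_single[of x 0 1] by simp

lemma eval_mpoly_power: "eval_mpoly x (f ^ n) = eval_mpoly x f ^ n"
  by (induction n) (simp_all add: eval_mpoly_mult)

lemma eval_mpoly_prod: "eval_mpoly x (\<Prod>i\<in>I. f i) = (\<Prod>i\<in>I. eval_mpoly x (f i))"
  by (induction I rule: infinite_finite_induct) (simp_all add: eval_mpoly_mult)

lemma eval_mpoly_Const [simp]: "eval_mpoly x (mpoly_Const c) = c"
  by (simp add: mpoly_Const_def eval_mpoly_single)

lemma eval_mpoly_Var [simp]: "eval_mpoly x (mpoly_Var i) = x $ i"
  by (simp add: mpoly_Var_def eval_mpoly_single)

text \<open>Formal substitution becomes restriction of the polynomial function to a plane.
  Membership in \<open>polys n\<close> guarantees that only coordinates below \<open>n\<close> are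
  read, where vector operations are determined.\<close>

lemma eval_mpoly_compose_proj:
  assumes "f \<in> polys n" "L (unit_vec 2 0) \<in> carrier_vec n" "L (unit_vec 2 1) \<in> carrier_vec n"
  shows "eval_mpoly y (compose_proj f L) =
    eval_mpoly (y $ 0 \<cdot>\<^sub>v L (unit_vec 2 0) + y $ 1 \<cdot>\<^sub>v L (unit_vec 2 1)) f"
proof -
  have "i < n" if "e \<in> Poly_Mapping.keys f" "i \<in> Poly_Mapping.keys e" for e i
    using assms(1) that by (auto simp: polys_def)
  then show ?thesis
    unfolding compose_proj_def subst_mpoly_def eval_mpoly_sum eval_mpoly_mult eval_mpoly_prod
      eval_mpoly_power eval_mpoly_add eval_mpoly_Const eval_mpoly_Var
    unfolding eval_mpoly_def subst_mpoly_def
    by (intro sum.cong refl arg_cong2[where f = "(*)"] prod.cong)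
      (use assms in \<open>simp add: mult.commute\<close>)
qed

lemma poly_compose_aff:
  assumes "f \<in> polys n" "L (unit_vec 2 0) \<in> carrier_vec n" "L (unit_vec 2 1) \<in> carrier_vec n"
  shows "poly (compose_aff f L) t =
    eval_mpoly (L (unit_vec 2 0) + t \<cdot>\<^sub>v L (unit_vec 2 1)) f"
proof -
  have "i < n" if "e \<in> Poly_Mapping.keys f" "i \<in> Poly_Mapping.keys e" for e i
    using assms(1) that by (auto simp: polys_def)
  then show ?thesis
    unfolding compose_aff_def eval_mpoly_def subst_mpoly_def poly_sum poly_mult poly_prod poly_power
    by (intro sum.cong refl arg_cong2[where f = "(*)"] prod.cong) (use assms in auto)
qed

section \<open>Monomials with prescribed exponents, and homogeneous polynomials\<close>

text \<open>Turns the functions that index the interpolation sums into exponent vectors; values of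
  \<open>e\<close> at \<open>n\<close> and beyond are cut off.\<close>

definition exponent :: "nat \<Rightarrow> (nat \<Rightarrow> nat) \<Rightarrow> nat \<Rightarrow>\<^sub>0 nat" where
  "exponent n e = (\<Sum>i<n. Poly_Mapping.single i (e i))"

lemma lookup_exponent: "Poly_Mapping.lookup (exponent n e) i = (if i < n then e i else 0)"
  by (simp add: exponent_def lookup_sum lookup_single when_def)

lemma keys_exponent: "Poly_Mapping.keys (exponent n e) \<subseteq> {..<n}"
  by (auto simp: in_keys_iff lookup_exponent split: if_splits)

lemma eval_mpoly_single_exponent:
  "eval_mpoly x (Poly_Mapping.single (exponent n e) c) = c * (\<Prod>i<n. x $ i ^ e i)"
  unfolding eval_mpoly_single prod_keys_superset[OF finite_lessThan keys_exponent]
  by (simp add: lookup_exponent)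

lemma single_exponent_in_polys: "Poly_Mapping.single (exponent n e) c \<in> polys n"
  using keys_exponent by (auto simp: polys_def split: if_splits)

lemma single_exponent_in_homogeneous_polys:
  assumes "(\<Sum>i<n. e i) = v"
  shows "Poly_Mapping.single (exponent n e) c \<in> homogeneous_polys n v"
proof -
  have "(\<Sum>i\<in>Poly_Mapping.keys (exponent n e). Poly_Mapping.lookup (exponent n e) i) =
      (\<Sum>i<n. Poly_Mapping.lookup (exponent n e) i)"
    by (rule sum.mono_neutral_left) (use keys_exponent in \<open>auto simp: in_keys_iff\<close>)
  then show ?thesis
    using single_exponent_in_polys[of n e c] assms
    by (simp add: homogeneous_polys_def lookup_exponent)
qed

lemma polys_sum: "(\<And>i. i \<in> I \<Longrightarrow> f i \<in> polys n) \<Longrightarrow> (\<Sum>i\<in>I. f i) \<in> polys n"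
  using keys_sum[of f I] unfolding polys_def by fast

lemma homogeneous_polys_sum:
  "(\<And>i. i \<in> I \<Longrightarrow> f i \<in> homogeneous_polys n v) \<Longrightarrow> (\<Sum>i\<in>I. f i) \<in> homogeneous_polys n v"
  using keys_sum[of f I] polys_sum[of I f n] unfolding homogeneous_polys_def by fast

lemma homogeneous_polys_in_polys: "f \<in> homogeneous_polys n v \<Longrightarrow> f \<in> polys n"
  by (simp add: homogeneous_polys_def)

lemma homogeneous_polys_keys:
  assumes "f \<in> homogeneous_polys n v" "e \<in> Poly_Mapping.keys f"
  shows "Poly_Mapping.keys e \<subseteq> {..<n}" "(\<Sum>i<n. Poly_Mapping.lookup e i) = v"
proof -
  show sub: "Poly_Mapping.keys e \<subseteq> {..<n}"
    using assms by (auto simp: homogeneous_polys_def polys_def)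
  have "(\<Sum>i<n. Poly_Mapping.lookup e i) = (\<Sum>i\<in>Poly_Mapping.keys e. Poly_Mapping.lookup e i)"
    by (rule sum.mono_neutral_right) (use sub in \<open>auto simp: in_keys_iff\<close>)
  then show "(\<Sum>i<n. Poly_Mapping.lookup e i) = v"
    using assms by (simp add: homogeneous_polys_def)
qed

lemma eval_mpoly_homogeneous:
  assumes "f \<in> homogeneous_polys n v"
  shows "eval_mpoly x f = (\<Sum>e\<in>Poly_Mapping.keys f. Poly_Mapping.lookup f e *
    (\<Prod>i<n. x $ i ^ Poly_Mapping.lookup e i))"
  unfolding eval_mpoly_def subst_mpoly_def
  by (intro sum.cong refl)
    (simp add: prod_keys_superset[OF _ homogeneous_polys_keys(1)[OF assms]])

lemma eval_mpoly_smult: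
  assumes "f \<in> homogeneous_polys n v" "x \<in> carrier_vec n"
  shows "eval_mpoly (c \<cdot>\<^sub>v x) f = c ^ v * eval_mpoly x f"
  unfolding eval_mpoly_homogeneous[OF assms(1)] sum_distrib_left
proof (rule sum.cong[OF refl])
  fix e assume e: "e \<in> Poly_Mapping.keys f"
  have "(\<Prod>i<n. (c \<cdot>\<^sub>v x) $ i ^ Poly_Mapping.lookup e i) =
      c ^ (\<Sum>i<n. Poly_Mapping.lookup e i) * (\<Prod>i<n. x $ i ^ Poly_Mapping.lookup e i)"
    using assms(2) by (simp add: power_mult_distrib prod.distrib power_sum)
  then show "Poly_Mapping.lookup f e * (\<Prod>i<n. (c \<cdot>\<^sub>v x) $ i ^ Poly_Mapping.lookup e i) =
      c ^ v * (Poly_Mapping.lookup f e * (\<Prod>i<n. x $ i ^ Poly_Mapping.lookup e i))"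
    by (simp add: homogeneous_polys_keys(2)[OF assms(1) e] mult_ac)
qed

text \<open>Passes from form functions back to formal polynomials, as membership in
  \<open>PRS\<close> demands; \<open>homogeneous_poly_imp_bivariate\<close> is the way in.\<close>

lemma bivariate_imp_homogeneous_poly:
  assumes "bivariate {k} f"
  shows "\<exists>g\<in>homogeneous_polys 2 k. \<forall>y. eval_mpoly y g = f (y $ 0) (y $ 1)"
  using assms
proof induction
  case zero
  show ?case by (rule bexI[of _ 0]) (simp_all add: homogeneous_polys_def polys_def)
next
  case (monomial i j c)
  let ?e = "\<lambda>l::nat. if l = 0 then i else j"
  show ?case
    by (rule bexI[of _ "Poly_Mapping.single (exponent 2 ?e) c"])
      (use monomial in \<open>auto simp: eval_mpoly_single_exponent numeral_2_eq_2 mult.assoc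
        intro: single_exponent_in_homogeneous_polys\<close>)
next
  case (add u v)
  then obtain g h where g: "g \<in> homogeneous_polys 2 k" "\<forall>y. eval_mpoly y g = u (y $ 0) (y $ 1)"
    and h: "h \<in> homogeneous_polys 2 k" "\<forall>y. eval_mpoly y h = v (y $ 0) (y $ 1)" by blast
  have "g + h \<in> homogeneous_polys 2 k"
    using g(1) h(1) keys_add[of g h] unfolding homogeneous_polys_def polys_def by fast
  then show ?case using g h by (intro bexI[of _ "g + h"]) (simp_all add: eval_mpoly_add)
qed

lemma homogeneous_poly_imp_bivariate:
  assumes "g \<in> homogeneous_polys 2 k"
  shows "bivariate {k} (\<lambda>s t. eval_mpoly (vec 2 (\<lambda>i. if i = 0 then s else t)) g)"
  unfolding eval_mpoly_homogeneous[OF assms]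
proof (rule bivariate_sum)
  fix e assume "e \<in> Poly_Mapping.keys g"
  then have "Poly_Mapping.lookup e 0 + Poly_Mapping.lookup e 1 \<in> {k}"
    using homogeneous_polys_keys(2)[OF assms] by (simp add: numeral_2_eq_2)
  from bivariate.monomial[OF this]
  show "bivariate {k} (\<lambda>s t. Poly_Mapping.lookup g e *
      (\<Prod>i<2. vec 2 (\<lambda>i. if i = 0 then s else t) $ i ^ Poly_Mapping.lookup e i))"
    by (simp add: numeral_2_eq_2 mult.assoc)
qed

section \<open>Coefficients of reduced polynomials\<close>

lemma bij_betw_vCons:
  "bij_betw (\<lambda>(s :: 'a, w). vCons s w) (UNIV \<times> carrier_vec n) (carrier_vec (Suc n))"
proof (rule bij_betw_imageI)
  show "inj_on (\<lambda>(s, w). vCons s w) (UNIV \<times> carrier_vec n)"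
    by (auto simp: inj_on_def)
  show "(\<lambda>(s :: 'a, w). vCons s w) ` (UNIV \<times> carrier_vec n) = carrier_vec (Suc n)"
  proof (intro equalityI subsetI)
    show "v \<in> (\<lambda>(s :: 'a, w). vCons s w) ` (UNIV \<times> carrier_vec n)" if "v \<in> carrier_vec (Suc n)" for v
      using that by (cases v) auto
  qed auto
qed

lemma finite_carrier_vec [simp]: "finite (carrier_vec n :: 'a::finite vec set)"
proof (induction n)
  case 0
  have "(carrier_vec 0 :: 'a vec set) \<subseteq> {vNil}" by auto
  then show ?case by (rule finite_subset) simp
next
  case (Suc n)
  then show ?case using bij_betw_finite[OF bij_betw_vCons[of n, where 'a='a]] by simp
qed

lemma sum_carrier_vec_Suc:
  fixes H :: "'a::finite vec \<Rightarrow> 'b::comm_monoid_add"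
  shows "(\<Sum>v\<in>carrier_vec (Suc n). H v) = (\<Sum>s\<in>UNIV. \<Sum>w\<in>carrier_vec n. H (vCons s w))"
  using sum.reindex_bij_betw[OF bij_betw_vCons[of n], of H]
  by (simp add: sum.cartesian_product case_prod_unfold)

lemma smult_vCons [simp]: "c \<cdot>\<^sub>v vCons a v = vCons (c * a) (c \<cdot>\<^sub>v v)"
  by (rule eq_vecI) (auto simp: vec_index_vCons)

lemma add_vCons [simp]: "dim_vec v = dim_vec w \<Longrightarrow> vCons a v + vCons b w = vCons (a + b) (v + w)"
  by (rule eq_vecI) (auto simp: vec_index_vCons)

lemma smult_zero_vec [simp]: "(c::'a::mult_zero) \<cdot>\<^sub>v 0\<^sub>v n = 0\<^sub>v n"
  by (rule eq_vecI) auto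

lemma zero_smult_vec [simp]: "v \<in> carrier_vec n \<Longrightarrow> (0::'a::mult_zero) \<cdot>\<^sub>v v = 0\<^sub>v n"
  by (rule eq_vecI) auto

lemma sum_const_carrier_vec_eq_0:
  assumes "0 < n"
  shows "(\<Sum>w\<in>(carrier_vec n :: 'a::{field,finite} vec set). c) = (0::'a)"
proof -
  obtain n' where "n = Suc n'" using assms by (cases n) auto
  then have "(\<Sum>w\<in>(carrier_vec n :: 'a vec set). c) = (\<Sum>s\<in>(UNIV :: 'a set). \<Sum>w\<in>(carrier_vec n' :: 'a vec set). c)"
    by (simp only: sum_carrier_vec_Suc)
  then show ?thesis by (simp add: of_nat_card_UNIV_eq_0)
qed

text \<open>
  Sums \<open>H\<close> over the planes spanned by \<open>e\<^sub>0\<close> and \<open>(0, w)\<close>, degenerate for \<open>w = 0\<close>. The point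
  \<open>(s, u)\<close> arises from the pairs \<open>(t, w)\<close> with \<open>t w = u\<close>; there are \<open>q - 1\<close> of them if \<open>u \<noteq> 0\<close> and
  \<open>q\<^sup>n + q - 1\<close> if \<open>u = 0\<close>, which is \<open>- 1\<close> in \<open>F\<close> either way.
\<close>

lemma sum_eq_0_if_low_degree_on_planes:
  fixes H :: "'a::{field,finite} vec \<Rightarrow> 'a"
  assumes "0 < n"
    and "\<And>x y. x \<in> carrier_vec (Suc n) \<Longrightarrow> y \<in> carrier_vec (Suc n) \<Longrightarrow>
      bivariate {..<2 * (CARD('a) - 1)} (\<lambda>s t. H (s \<cdot>\<^sub>v x + t \<cdot>\<^sub>v y))"
  shows "(\<Sum>v\<in>carrier_vec (Suc n). H v) = 0"
proof -
  let ?C = "carrier_vec n :: 'a vec set"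
  have plane: "(\<Sum>s\<in>UNIV. \<Sum>t\<in>UNIV. H (vCons s (t \<cdot>\<^sub>v w))) = 0" if w: "w \<in> ?C" for w
  proof -
    have "s \<cdot>\<^sub>v vCons 1 (0\<^sub>v n) + t \<cdot>\<^sub>v vCons 0 w = vCons s (t \<cdot>\<^sub>v w)" for s t
      using w by simp
    then show ?thesis
      using bivariate_sum_eq_0[OF assms(2)[of "vCons 1 (0\<^sub>v n)" "vCons 0 w"]] w by simp
  qed
  \<comment> \<open>For \<open>t = 0\<close> a constant is summed over q^n vectors, which gives 0
    because \<open>0 < n\<close>; for other \<open>t\<close> scaling permutes the vectors.\<close>
  have scale: "(\<Sum>w\<in>?C. H (vCons s (t \<cdot>\<^sub>v w))) = (if t = 0 then 0 else \<Sum>w\<in>?C. H (vCons s w))" for s t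
  proof (cases "t = 0")
    case True
    have "(\<Sum>w\<in>?C. H (vCons s (0 \<cdot>\<^sub>v w))) = (\<Sum>w\<in>?C. H (vCons s (0\<^sub>v n)))"
      by (rule sum.cong) auto
    then show ?thesis using True sum_const_carrier_vec_eq_0[OF assms(1)] by simp
  next
    case False
    have "bij_betw ((\<cdot>\<^sub>v) t) ?C ?C"
      by (rule bij_betwI[where g = "(\<cdot>\<^sub>v) (inverse t)"]) (use False in \<open>auto simp: smult_smult_assoc\<close>)
    from sum.reindex_bij_betw[OF this] show ?thesis using False by simp
  qed
  have "0 = (\<Sum>w\<in>?C. \<Sum>s\<in>UNIV. \<Sum>t\<in>UNIV. H (vCons s (t \<cdot>\<^sub>v w)))"
    by (simp add: plane)
  also have "\<dots> = (\<Sum>s\<in>UNIV. \<Sum>t\<in>UNIV. \<Sum>w\<in>?C. H (vCons s (t \<cdot>\<^sub>v w)))"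
    by (subst sum.swap, rule sum.cong[OF refl], rule sum.swap)
  \<comment> \<open>Every nonzero \<open>t\<close> contributes the same inner sum, and there are q -
    1 of them, which is -1 in the field.\<close>
  also have "\<dots> = (\<Sum>s\<in>UNIV. \<Sum>t\<in>UNIV - {0::'a}. \<Sum>w\<in>?C. H (vCons s w))"
    unfolding scale by (intro sum.cong refl sum.mono_neutral_cong_right) auto
  also have "\<dots> = - (\<Sum>v\<in>carrier_vec (Suc n). H v)"
    by (simp add: sum_carrier_vec_Suc card_Diff_singleton of_nat_diff Suc_leI
        of_nat_card_UNIV_eq_0 sum_negf)
  finally show ?thesis by simp
qed

section \<open>Interpolation by reduced polynomials\<close>

text \<open>For exponents below q the factor at \<open>i\<close> is the coefficient of X^(e i) in 1
  - (X - a_i)^(q-1), the polynomial that is 1 at a_i and 0 elsewhere. The whole sum is thus a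
  coefficient of the reduced polynomial of \<open>h\<close>.\<close>

definition interpolation_coeff :: "nat \<Rightarrow> ('a::{field,finite} vec \<Rightarrow> 'a) \<Rightarrow> (nat \<Rightarrow> nat) \<Rightarrow> 'a" where
  "interpolation_coeff n h e = (\<Sum>a\<in>carrier_vec n. h a *
     (\<Prod>i<n. (if e i = 0 then 1 else 0) - (a $ i) ^ (CARD('a) - 1 - e i)))"

text \<open>
  Expands \<open>h x = (\<Sum>a. h a * (\<Prod>i. 1 - (x\<^sub>i - a\<^sub>i) ^ (q - 1)))\<close>, with
  \<open>(x - a) ^ (q - 1) = (\<Sum>j<q. x ^ j * a ^ (q - 1 - j))\<close>.
\<close>

lemma interpolation:
  fixes h :: "'a::{field,finite} vec \<Rightarrow> 'a"
  assumes x: "x \<in> carrier_vec n"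
  shows "h x = (\<Sum>e\<in>{..<n} \<rightarrow>\<^sub>E {..<CARD('a)}. interpolation_coeff n h e * (\<Prod>i<n. x $ i ^ e i))"
proof -
  let ?c = "\<lambda>a j. (if j = 0 then 1 else 0) - a ^ (CARD('a) - 1 - j) :: 'a"
  let ?E = "{..<n} \<rightarrow>\<^sub>E {..<CARD('a)}"
  have delta: "(\<Sum>j<CARD('a). ?c a j * y ^ j) = (if y = a then 1 else 0)" for a y
  proof -
    have "(\<Sum>j<CARD('a). ?c a j * y ^ j) =
        (\<Sum>j<CARD('a). (if j = 0 then 1 else 0) - y ^ j * a ^ (CARD('a) - 1 - j))"
      by (rule sum.cong) (auto simp: algebra_simps)
    then show ?thesis
      using finite_field_delta[of y a] by (simp add: sum_subtractf sum.delta)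
  qed
  have "(\<Sum>e\<in>?E. interpolation_coeff n h e * (\<Prod>i<n. x $ i ^ e i)) =
      (\<Sum>a\<in>carrier_vec n. \<Sum>e\<in>?E. h a * (\<Prod>i<n. ?c (a $ i) (e i) * x $ i ^ e i))"
    unfolding interpolation_coeff_def
    by (subst sum.swap) (simp add: sum_distrib_right prod.distrib mult.assoc)
  also have "\<dots> = (\<Sum>a\<in>carrier_vec n. h a * (\<Prod>i<n. \<Sum>j<CARD('a). ?c (a $ i) j * x $ i ^ j))"
    by (simp add: prod_sum_PiE sum_distrib_left)
  also have "\<dots> = (\<Sum>a\<in>carrier_vec n. if a = x then h a else 0)"
  proof (rule sum.cong[OF refl])
    fix a :: "'a vec" assume a: "a \<in> carrier_vec n"
    have "(\<Prod>i<n. if x $ i = a $ i then 1 else 0 :: 'a) = (if a = x then 1 else 0)"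
    proof (cases "a = x")
      case False
      then obtain i where "i < n" "x $ i \<noteq> a $ i" using a x by (metis eq_vecI carrier_vecD)
      then show ?thesis using False by (auto intro: prod_zero)
    qed simp
    then show "h a * (\<Prod>i<n. \<Sum>j<CARD('a). ?c (a $ i) j * x $ i ^ j) = (if a = x then h a else 0)"
      unfolding delta by simp
  qed
  also have "\<dots> = h x" using x by simp
  finally show ?thesis by simp
qed

text \<open>Makes the existence of a polynomial behind an affine codeword automatic, leaving only
  the condition on lines.\<close>

lemma obtain_polynomial:
  fixes h :: "'a::{field,finite} vec \<Rightarrow> 'a"
  obtains f where "f \<in> polys n" "\<And>x. x \<in> carrier_vec n \<Longrightarrow> eval_mpoly x f = h x"
proof
  let ?f = "\<Sum>e\<in>{..<n} \<rightarrow>\<^sub>E {..<CARD('a)}. Poly_Mapping.single (exponent n e) (interpolation_coeff n h e)"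
  show "?f \<in> polys n" by (intro polys_sum single_exponent_in_polys)
  show "eval_mpoly x ?f = h x" if "x \<in> carrier_vec n" for x
    using interpolation[OF that, of h] by (simp add: eval_mpoly_sum eval_mpoly_single_exponent)
qed

section \<open>Degrees of the monomials in a planewise form\<close>

text \<open>The vectors \<open>x\<close> and \<open>y\<close> may be dependent. Degenerate planes
  encode homogeneity along lines, and linear images of planes need no case distinction.\<close>

definition planewise_form :: "nat \<Rightarrow> nat \<Rightarrow> ('a::field vec \<Rightarrow> 'a) \<Rightarrow> bool" where
  "planewise_form n k G \<longleftrightarrow> (\<forall>x\<in>carrier_vec n. \<forall>y\<in>carrier_vec n.
     bivariate {k} (\<lambda>s t. G (s \<cdot>\<^sub>v x + t \<cdot>\<^sub>v y)))"

lemma planewise_formD: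
  "planewise_form n k G \<Longrightarrow> x \<in> carrier_vec n \<Longrightarrow> y \<in> carrier_vec n \<Longrightarrow>
    bivariate {k} (\<lambda>s t. G (s \<cdot>\<^sub>v x + t \<cdot>\<^sub>v y))"
  by (simp add: planewise_form_def)

lemma bivariate_form_smult:
  "bivariate {k} f \<Longrightarrow> f (c * s) (c * t) = c ^ k * f s t"
  by (induction rule: bivariate.induct) (auto simp: algebra_simps power_mult_distrib power_add)

text \<open>Read off the degenerate plane spanned by \<open>x\<close> and 0, at the parameters (1,
  0) scaled by \<open>c\<close>.\<close>

lemma planewise_form_smult:
  assumes "planewise_form n k G" "x \<in> carrier_vec n"
  shows "G (c \<cdot>\<^sub>v x) = c ^ k * G x"
  using bivariate_form_smult[OF planewise_formD[OF assms(1,2) zero_carrier_vec], of c 1 0] assms(2)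
  by (simp add: right_zero_vec[of _ n])

lemma planewise_form_zero:
  assumes "planewise_form n k G" "0 < k"
  shows "G (0\<^sub>v n) = 0"
  using planewise_form_smult[OF assms(1) zero_carrier_vec, of 0] assms(2)
  by (simp add: power_0_left)

text \<open>The coefficient is a sum over all vectors of a function that on each plane is a form of
  degree \<open>k\<close> times a polynomial of the complementary degree; the total stays below 2(q
  - 1).\<close>

lemma interpolation_coeff_eq_0_if_large:
  fixes G :: "'a::{field,finite} vec \<Rightarrow> 'a"
  assumes G: "planewise_form (Suc n) k G" and n: "0 < n"
    and e: "\<And>i. i < Suc n \<Longrightarrow> e i < CARD('a)"
    and large: "k + (n - 1) * (CARD('a) - 1) < (\<Sum>i<Suc n. e i)"
  shows "interpolation_coeff (Suc n) G e = 0"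
  unfolding interpolation_coeff_def
proof (rule sum_eq_0_if_low_degree_on_planes[OF n])
  fix x y :: "'a vec" assume xy: "x \<in> carrier_vec (Suc n)" "y \<in> carrier_vec (Suc n)"
  let ?q = "CARD('a) - 1"
  let ?d = "\<Sum>i<Suc n. ?q - e i"
  have "(\<Sum>i<Suc n. ?q - e i) + (\<Sum>i<Suc n. e i) = (\<Sum>i<Suc n. ?q - e i + e i)"
    by (rule sum.distrib[symmetric])
  \<comment> \<open>Natural subtraction is exact here because each \<open>e i\<close> is at most q -
    1.\<close>
  also have "\<dots> = (\<Sum>i<Suc n. ?q)"
    by (rule sum.cong) (use e in force)+
  also have "\<dots> = (n - 1) * ?q + 2 * ?q"
    using n by (cases n) simp_all
  finally have deg: "k + ?d < 2 * ?q" using large by linarith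
  have "bivariate {..?d} (\<lambda>s t. \<Prod>i<Suc n. (if e i = 0 then 1 else 0) - (s * x $ i + t * y $ i) ^ (?q - e i))"
  proof (rule bivariate_prod)
    fix i
    have "bivariate {..?q - e i} (\<lambda>s t. (s * x $ i + t * y $ i) ^ (?q - e i))"
      using bivariate_mono[OF bivariate_power[OF bivariate_linear[of "{1}"]], of "?q - e i" "{..?q - e i}"]
      by simp
    then have "bivariate {..?q - e i} (\<lambda>s t. (if e i = 0 then 1 else 0) + (- 1) * (s * x $ i + t * y $ i) ^ (?q - e i))"
      by (intro bivariate.add bivariate_const bivariate_mult[of "{0}" _ "{..?q - e i}"]) auto
    then show "bivariate {..?q - e i} (\<lambda>s t. (if e i = 0 then 1 else 0) - (s * x $ i + t * y $ i) ^ (?q - e i))"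
      by simp
  qed simp
  then have "bivariate {..<2 * ?q} (\<lambda>s t. G (s \<cdot>\<^sub>v x + t \<cdot>\<^sub>v y) *
      (\<Prod>i<Suc n. (if e i = 0 then 1 else 0) - (s * x $ i + t * y $ i) ^ (?q - e i)))"
    by (rule bivariate_mult[OF planewise_formD[OF G xy]]) (use deg in auto)
  then show "bivariate {..<2 * ?q} (\<lambda>s t. G (s \<cdot>\<^sub>v x + t \<cdot>\<^sub>v y) *
      (\<Prod>i<Suc n. (if e i = 0 then 1 else 0) - (s \<cdot>\<^sub>v x + t \<cdot>\<^sub>v y) $ i ^ (?q - e i)))"
    using xy by simp
qed

text \<open>Replacing the summation variable \<open>a\<close> by its multiple by \<open>c\<close>
  scales \<open>G\<close> by c^k and the product by the inverse of c^(deg e). A nonzero coefficient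
  forces the two powers of \<open>c\<close> to agree.\<close>

lemma interpolation_coeff_degree_cong:
  fixes G :: "'a::{field,finite} vec \<Rightarrow> 'a"
  assumes G: "\<And>c x. x \<in> carrier_vec n \<Longrightarrow> G (c \<cdot>\<^sub>v x) = c ^ k * G x"
    and e: "\<And>i. i < n \<Longrightarrow> e i < CARD('a)"
    and nz: "interpolation_coeff n G e \<noteq> 0"
  shows "(\<Sum>i<n. e i) mod (CARD('a) - 1) = k mod (CARD('a) - 1)"
proof (rule finite_field_power_eq_imp_mod_eq)
  fix c :: 'a assume c: "c \<noteq> 0"
  let ?q = "CARD('a) - 1"
  let ?P = "\<lambda>a. \<Prod>i<n. (if e i = 0 then 1 else 0) - (a $ i) ^ (?q - e i)"
  have P: "c ^ (\<Sum>i<n. e i) * ?P (c \<cdot>\<^sub>v a) = ?P a" if "a \<in> carrier_vec n" for a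
  proof -
    have "c ^ e i * ((if e i = 0 then 1 else 0) - (c * a $ i) ^ (?q - e i)) =
        (if e i = 0 then 1 else 0) - (a $ i) ^ (?q - e i)" if "i < n" for i
    proof -
      have "c ^ e i * c ^ (?q - e i) = c ^ ?q"
        using e[OF that] by (simp flip: power_add)
      then have "c ^ e i * (c ^ (?q - e i) * b) = b" for b
        using finite_field_power_card_minus_one[OF c] by (simp flip: mult.assoc)
      then show ?thesis by (auto simp only: right_diff_distrib power_mult_distrib power_0 mult_1 mult_zero_right split: if_splits)
    qed
    then show ?thesis
      using that by (simp add: power_sum flip: prod.distrib)
  qed
  have bij: "bij_betw ((\<cdot>\<^sub>v) c) (carrier_vec n) (carrier_vec n)"
    by (rule bij_betwI[where g = "(\<cdot>\<^sub>v) (inverse c)"]) (use c in \<open>auto simp: smult_smult_assoc\<close>)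
  have "c ^ (\<Sum>i<n. e i) * interpolation_coeff n G e =
      c ^ (\<Sum>i<n. e i) * (\<Sum>a\<in>carrier_vec n. G (c \<cdot>\<^sub>v a) * ?P (c \<cdot>\<^sub>v a))"
    unfolding interpolation_coeff_def
    using sum.reindex_bij_betw[OF bij, of "\<lambda>a. G a * ?P a"] by simp
  also have "\<dots> = (\<Sum>a\<in>carrier_vec n. c ^ k * G a * (c ^ (\<Sum>i<n. e i) * ?P (c \<cdot>\<^sub>v a)))"
    unfolding sum_distrib_left by (rule sum.cong) (simp_all only: G mult_ac)
  also have "\<dots> = c ^ k * interpolation_coeff n G e"
    unfolding interpolation_coeff_def sum_distrib_left
    by (rule sum.cong) (simp_all only: P mult_ac)
  finally show "c ^ (\<Sum>i<n. e i) = c ^ k" using nz by simp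
qed

text \<open>The product becomes that of the factors 1 - a_i^(q-1), the indicator of the origin. For
  a planewise form of positive degree this excludes a constant term.\<close>

lemma interpolation_coeff_0:
  fixes G :: "'a::{field,finite} vec \<Rightarrow> 'a"
  assumes "\<And>i. i < n \<Longrightarrow> e i = 0"
  shows "interpolation_coeff n G e = G (0\<^sub>v n)"
proof -
  have "(\<Prod>i<n. (if e i = 0 then 1 else 0) - (a $ i) ^ (CARD('a) - 1 - e i)) = (if a = 0\<^sub>v n then 1 else 0)"
    if a: "a \<in> carrier_vec n" for a :: "'a vec"
  proof (cases "a = 0\<^sub>v n")
    case True
    then show ?thesis using assms CARD_field_ge_2[where 'a='a] by (simp add: power_0_left)
  next
    case False
    then obtain i where "i < n" "a $ i \<noteq> 0"
      using a by (metis eq_vecI carrier_vecD index_zero_vec)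
    then show ?thesis
      using False assms finite_field_power_card_minus_one[of "a $ i"] by (auto intro: prod_zero)
  qed
  then have "interpolation_coeff n G e = (\<Sum>a\<in>carrier_vec n. G a * (if a = 0\<^sub>v n then 1 else 0))"
    unfolding interpolation_coeff_def by simp
  also have "\<dots> = (\<Sum>a\<in>carrier_vec n. if a = 0\<^sub>v n then G a else 0)"
    by (rule sum.cong) auto
  finally show ?thesis by simp
qed

text \<open>The missing multiple of q - 1 goes onto one variable that already occurs; on an absent
  variable it would change the value at 0.\<close>

lemma ex_monomial_of_higher_degree:
  fixes e :: "nat \<Rightarrow> nat"
  assumes "(\<Sum>i<n. e i) mod (CARD('a::{field,finite}) - 1) = v mod (CARD('a) - 1)"
    and "(\<Sum>i<n. e i) \<le> v" and "j < n" "0 < e j"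
  shows "\<exists>e'. (\<Sum>i<n. e' i) = v \<and> (\<forall>x::'a vec. (\<Prod>i<n. x $ i ^ e' i) = (\<Prod>i<n. x $ i ^ e i))"
proof -
  obtain r where r: "v = (\<Sum>i<n. e i) + r * (CARD('a) - 1)"
    using assms(1,2) by (metis le_add_diff_inverse mod_eq_dvd_iff_nat dvd_def mult.commute)
  let ?e = "e(j := e j + r * (CARD('a) - 1))"
  have "(\<Sum>i<n. ?e i) = v"
    using \<open>j < n\<close> by (simp add: r sum.remove[of "{..<n}" j])
  moreover have "x $ i ^ ?e i = x $ i ^ e i" for x :: "'a vec" and i
    using finite_field_power_add_card[OF \<open>0 < e j\<close>, of "x $ j" r] by (cases "i = j") simp_all
  ultimately show ?thesis by (intro exI[of _ ?e] conjI allI prod.cong refl)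
qed

text \<open>Each monomial of the reduced polynomial is nonconstant, has degree at most v, and is
  congruent to v modulo q - 1, so it can be raised to degree exactly v.\<close>

lemma planewise_form_imp_homogeneous_poly:
  fixes G :: "'a::{field,finite} vec \<Rightarrow> 'a"
  assumes G: "planewise_form (Suc n) k G" and "0 < n" "0 < k"
  shows "\<exists>f\<in>homogeneous_polys (Suc n) (k + (n - 1) * (CARD('a) - 1)).
    \<forall>x\<in>carrier_vec (Suc n). eval_mpoly x f = G x"
proof -
  let ?v = "k + (n - 1) * (CARD('a) - 1)"
  let ?E = "{e \<in> {..<Suc n} \<rightarrow>\<^sub>E {..<CARD('a)}. interpolation_coeff (Suc n) G e \<noteq> 0}"
  have "\<exists>e'. (\<Sum>i<Suc n. e' i) = ?v \<and>
      (\<forall>x::'a vec. (\<Prod>i<Suc n. x $ i ^ e' i) = (\<Prod>i<Suc n. x $ i ^ e i))" if "e \<in> ?E" for e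
  proof -
    have e: "\<And>i. i < Suc n \<Longrightarrow> e i < CARD('a)" and nz: "interpolation_coeff (Suc n) G e \<noteq> 0"
      using that by auto
    have "\<not> (\<forall>i<Suc n. e i = 0)"
      using nz interpolation_coeff_0[of "Suc n" e G] planewise_form_zero[OF G \<open>0 < k\<close>] by metis
    then obtain j where j: "j < Suc n" "0 < e j" by (meson neq0_conv)
    have "(\<Sum>i<Suc n. e i) mod (CARD('a) - 1) = ?v mod (CARD('a) - 1)"
      using interpolation_coeff_degree_cong[OF planewise_form_smult[OF G] e nz] by simp
    moreover have "(\<Sum>i<Suc n. e i) \<le> ?v"
      using interpolation_coeff_eq_0_if_large[OF G \<open>0 < n\<close> e] nz by (meson not_le)
    ultimately show ?thesis using ex_monomial_of_higher_degree j by blast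
  qed
  then have "\<exists>e'. \<forall>e\<in>?E. (\<Sum>i<Suc n. e' e i) = ?v \<and>
      (\<forall>x::'a vec. (\<Prod>i<Suc n. x $ i ^ e' e i) = (\<Prod>i<Suc n. x $ i ^ e i))"
    by (intro bchoice ballI)
  then obtain e' where e': "\<And>e. e \<in> ?E \<Longrightarrow> (\<Sum>i<Suc n. e' e i) = ?v"
    "\<And>e x. e \<in> ?E \<Longrightarrow> (\<Prod>i<Suc n. (x::'a vec) $ i ^ e' e i) = (\<Prod>i<Suc n. x $ i ^ e i)"
    by blast
  \<comment> \<open>Distinct \<open>e\<close> may be raised to the same monomial; merging or
    cancelling such terms harms neither the evaluation nor homogeneity.\<close>
  let ?f = "\<Sum>e\<in>?E. Poly_Mapping.single (exponent (Suc n) (e' e)) (interpolation_coeff (Suc n) G e)"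
  have "eval_mpoly x ?f = G x" if x: "x \<in> carrier_vec (Suc n)" for x
  proof -
    have "G x = (\<Sum>e\<in>?E. interpolation_coeff (Suc n) G e * (\<Prod>i<Suc n. x $ i ^ e i))"
      unfolding interpolation[OF x, of G]
      by (rule sum.mono_neutral_right) (auto intro: finite_PiE)
    also have "\<dots> = eval_mpoly x ?f"
      unfolding eval_mpoly_sum eval_mpoly_single_exponent
      by (rule sum.cong[OF refl]) (simp only: e'(2))
    finally show ?thesis by simp
  qed
  moreover have "?f \<in> homogeneous_polys (Suc n) ?v"
    by (intro homogeneous_polys_sum single_exponent_in_homogeneous_polys e'(1))
  ultimately show ?thesis by blast
qed

section \<open>Projective points and their representatives\<close>

lemma proj_rel_Image:
  assumes "x \<in> carrier_vec (Suc n)" "x \<noteq> 0\<^sub>v (Suc n)"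
  shows "proj_rel n `` {x} = {c \<cdot>\<^sub>v x |c. c \<noteq> 0}"
proof -
  have "c \<cdot>\<^sub>v x \<noteq> 0\<^sub>v (Suc n)" if "c \<noteq> 0" for c
  proof
    assume "c \<cdot>\<^sub>v x = 0\<^sub>v (Suc n)"
    then have "inverse c \<cdot>\<^sub>v (c \<cdot>\<^sub>v x) = 0\<^sub>v (Suc n)" by simp
    then show False using that assms by (simp add: smult_smult_assoc)
  qed
  then show ?thesis using assms by (auto simp: proj_rel_def)
qed

lemma proj_spaceI:
  "x \<in> carrier_vec (Suc n) \<Longrightarrow> x \<noteq> 0\<^sub>v (Suc n) \<Longrightarrow> proj_rel n `` {x} \<in> proj_space n"
  by (simp add: proj_space_def quotientI)

lemma proj_spaceE:
  assumes "P \<in> proj_space n"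
  obtains x where "x \<in> carrier_vec (Suc n)" "x \<noteq> 0\<^sub>v (Suc n)" "P = proj_rel n `` {x}"
  using assms by (auto simp: proj_space_def elim: quotientE)

text \<open>Nonzero scaling keeps the position of the leading entry, which is 1 in both vectors.
  This gives uniqueness of the standard representative.\<close>

lemma is_standard_smult_imp_eq_1:
  assumes "is_standard x" "is_standard (c \<cdot>\<^sub>v x)"
  shows "c = 1"
proof -
  obtain i where i: "i < dim_vec x" "x $ i = 1" "\<forall>j<i. x $ j = 0"
    using assms(1) by (auto simp: is_standard_def)
  obtain j where j: "j < dim_vec x" "c * x $ j = 1" "\<forall>l<j. c * x $ l = 0"
    using assms(2) by (auto simp: is_standard_def)
  have "c \<noteq> 0" using j(2) by auto
  then have "i = j" using i j by (metis linorder_neqE_nat mult_eq_0_iff mult_zero_right one_neq_zero less_trans)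
  then show ?thesis using i j by simp
qed

lemma standard_rep_eq:
  assumes "P \<in> proj_space n" "z \<in> P" "is_standard z"
  shows "standard_rep P = z"
  unfolding standard_rep_def
proof (rule the_equality)
  fix y assume y: "y \<in> P \<and> is_standard y"
  obtain x where x: "x \<in> carrier_vec (Suc n)" "x \<noteq> 0\<^sub>v (Suc n)" "P = proj_rel n `` {x}"
    using assms(1) by (rule proj_spaceE)
  obtain a b where ab: "z = a \<cdot>\<^sub>v x" "y = b \<cdot>\<^sub>v x" "a \<noteq> 0"
    using assms(2) y unfolding x(3) proj_rel_Image[OF x(1,2)] by auto
  then have "y = (b / a) \<cdot>\<^sub>v z" by (simp add: smult_smult_assoc)
  then show "y = z" using is_standard_smult_imp_eq_1[of z "b / a"] y assms(3) by auto
qed (use assms in simp)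

lemma ex_standard_multiple:
  assumes "x \<in> carrier_vec n" "x \<noteq> 0\<^sub>v n"
  shows "\<exists>c::'a::field. c \<noteq> 0 \<and> is_standard (c \<cdot>\<^sub>v x)"
proof -
  \<comment> \<open>The position of the leading nonzero coordinate, by whose inverse the vector is
    scaled.\<close>
  define i where "i = (LEAST i. i < n \<and> x $ i \<noteq> 0)"
  have "\<exists>i. i < n \<and> x $ i \<noteq> 0"
    using assms by (metis eq_vecI carrier_vecD index_zero_vec)
  then have i: "i < n" "x $ i \<noteq> 0"
    unfolding i_def by (metis (mono_tags, lifting) LeastI_ex)+
  have "x $ j = 0" if "j < i" for j
    using not_less_Least[of j "\<lambda>i. i < n \<and> x $ i \<noteq> 0"] that i(1) unfolding i_def[symmetric] by simp
  then show ?thesis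
    using i assms(1) by (intro exI[of _ "inverse (x $ i)"]) (auto simp: is_standard_def)
qed

lemma standard_rep_proj_rel_Image:
  assumes "x \<in> carrier_vec (Suc n)" "x \<noteq> 0\<^sub>v (Suc n)"
  obtains c where "c \<noteq> 0" "standard_rep (proj_rel n `` {x}) = c \<cdot>\<^sub>v x"
    "is_standard (c \<cdot>\<^sub>v x)"
proof -
  obtain c where c: "c \<noteq> 0" "is_standard (c \<cdot>\<^sub>v x)"
    using ex_standard_multiple[OF assms] by auto
  then have "standard_rep (proj_rel n `` {x}) = c \<cdot>\<^sub>v x"
    using assms by (intro standard_rep_eq[OF proj_spaceI]) (auto simp: proj_rel_Image)
  then show ?thesis using that c by blast
qed

lemma standard_rep:
  assumes "P \<in> proj_space n"
  shows "standard_rep P \<in> P" "standard_rep P \<in> carrier_vec (Suc n)" "is_standard (standard_rep P)"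
proof -
  obtain x where x: "x \<in> carrier_vec (Suc n)" "x \<noteq> 0\<^sub>v (Suc n)" "P = proj_rel n `` {x}"
    using assms by (rule proj_spaceE)
  then obtain c where "c \<noteq> 0" "standard_rep P = c \<cdot>\<^sub>v x" "is_standard (c \<cdot>\<^sub>v x)"
    using standard_rep_proj_rel_Image by blast
  then show "standard_rep P \<in> P" "standard_rep P \<in> carrier_vec (Suc n)" "is_standard (standard_rep P)"
    using x by (auto simp: proj_rel_Image)
qed

text \<open>Every nonzero vector is proportional to a standard representative, and the common factor
  c^k cancels; at the origin both sides vanish since \<open>0 < k\<close>.\<close>

lemma eq_if_eq_on_standard_reps:
  fixes F G :: "'a::field vec \<Rightarrow> 'a"
  assumes F: "\<And>c x. x \<in> carrier_vec (Suc n) \<Longrightarrow> F (c \<cdot>\<^sub>v x) = c ^ k * F x"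
    and G: "\<And>c x. x \<in> carrier_vec (Suc n) \<Longrightarrow> G (c \<cdot>\<^sub>v x) = c ^ k * G x"
    and "0 < k"
    and eq: "\<And>P. P \<in> proj_space n \<Longrightarrow> F (standard_rep P) = G (standard_rep P)"
    and x: "x \<in> carrier_vec (Suc n)"
  shows "F x = G x"
proof (cases "x = 0\<^sub>v (Suc n)")
  case True
  then show ?thesis using F[OF x, of 0] G[OF x, of 0] \<open>0 < k\<close> by (simp add: power_0_left)
next
  case False
  then obtain c where "c \<noteq> 0" "standard_rep (proj_rel n `` {x}) = c \<cdot>\<^sub>v x"
    using standard_rep_proj_rel_Image x by blast
  then show ?thesis using eq[OF proj_spaceI[OF x False]] F[OF x, of c] G[OF x, of c] by simp
qed

lemma standard_rep_affine_point:
  assumes "a \<in> carrier_vec m"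
  shows "proj_rel m `` {vCons 1 a} \<in> proj_space m"
    "standard_rep (proj_rel m `` {vCons 1 a}) = vCons 1 a"
proof -
  have nz: "vCons 1 a \<noteq> 0\<^sub>v (Suc m)" by (simp add: zero_vec_Suc)
  show P: "proj_rel m `` {vCons 1 a} \<in> proj_space m"
    using assms nz by (intro proj_spaceI) simp_all
  have "vCons 1 a \<in> proj_rel m `` {vCons 1 a}"
    using assms nz by (subst proj_rel_Image) (auto intro!: exI[of _ 1])
  moreover have "is_standard (vCons 1 a)"
    unfolding is_standard_def by (rule exI[of _ 0]) simp
  ultimately show "standard_rep (proj_rel m `` {vCons 1 a}) = vCons 1 a"
    by (rule standard_rep_eq[OF P])
qed

lemma standard_rep_at_infinity:
  assumes "Q \<in> proj_space n"
  shows "vCons 0 ` Q \<in> proj_space (Suc n)" "standard_rep (vCons 0 ` Q) = vCons 0 (standard_rep Q)"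
proof -
  obtain x where x: "x \<in> carrier_vec (Suc n)" "x \<noteq> 0\<^sub>v (Suc n)" "Q = proj_rel n `` {x}"
    using assms by (rule proj_spaceE)
  have x': "vCons 0 x \<in> carrier_vec (Suc (Suc n))" "vCons 0 x \<noteq> 0\<^sub>v (Suc (Suc n))"
    using x(1,2) by (simp_all add: zero_vec_Suc[of "Suc n"])
  have "vCons 0 ` Q = proj_rel (Suc n) `` {vCons 0 x}"
    unfolding x(3) proj_rel_Image[OF x(1,2)] proj_rel_Image[OF x'] by auto
  then show P: "vCons 0 ` Q \<in> proj_space (Suc n)" using proj_spaceI[OF x'] by simp
  obtain i where i: "i < dim_vec (standard_rep Q)" "standard_rep Q $ i = 1"
      "\<forall>j<i. standard_rep Q $ j = 0"
    using standard_rep(3)[OF assms] by (auto simp: is_standard_def)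
  have "is_standard (vCons 0 (standard_rep Q))"
    unfolding is_standard_def using i by (intro exI[of _ "Suc i"]) (auto simp: vec_index_vCons)
  then show "standard_rep (vCons 0 ` Q) = vCons 0 (standard_rep Q)"
    using standard_rep(1)[OF assms] by (intro standard_rep_eq[OF P]) auto
qed

section \<open>Functions that are forms on planes\<close>

lemma linear_maps_2_unit_vec:
  "L \<in> linear_maps 2 d \<Longrightarrow> L (unit_vec 2 i) \<in> carrier_vec d"
  by (auto simp: linear_maps_def)

section \<open>Parametrised planes, degenerate ones included\<close>

text \<open>Restricted to the carrier because \<open>linear_maps\<close> consists of extensional
  functions.\<close>

definition plane_map :: "'a::field vec \<Rightarrow> 'a vec \<Rightarrow> 'a vec \<Rightarrow> 'a vec" where
  "plane_map x y = (\<lambda>z\<in>carrier_vec 2. z $ 0 \<cdot>\<^sub>v x + z $ 1 \<cdot>\<^sub>v y)"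

lemma plane_map_linear:
  assumes "x \<in> carrier_vec d" "y \<in> carrier_vec d"
  shows "plane_map x y \<in> linear_maps 2 d"
proof -
  have "(u $ 0 + v $ 0) \<cdot>\<^sub>v x + (u $ 1 + v $ 1) \<cdot>\<^sub>v y =
      (u $ 0 \<cdot>\<^sub>v x + u $ 1 \<cdot>\<^sub>v y) + (v $ 0 \<cdot>\<^sub>v x + v $ 1 \<cdot>\<^sub>v y)" for u v
    by (rule eq_vecI) (use assms in \<open>auto simp: algebra_simps\<close>)
  moreover have "(c * u $ 0) \<cdot>\<^sub>v x + (c * u $ 1) \<cdot>\<^sub>v y = c \<cdot>\<^sub>v (u $ 0 \<cdot>\<^sub>v x + u $ 1 \<cdot>\<^sub>v y)" for c u
    by (rule eq_vecI) (use assms in \<open>auto simp: algebra_simps\<close>)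
  ultimately show ?thesis
    using assms by (auto simp: linear_maps_def plane_map_def)
qed

lemma plane_map_unit_vec:
  assumes "x \<in> carrier_vec d" "y \<in> carrier_vec d"
  shows "plane_map x y (unit_vec 2 0) = x" "plane_map x y (unit_vec 2 1) = y"
  using assms by (auto simp: plane_map_def)

lemma inj_on_linear_map:
  assumes "L \<in> linear_maps n d" and "\<And>z. z \<in> carrier_vec n \<Longrightarrow> L z = 0\<^sub>v d \<Longrightarrow> z = 0\<^sub>v n"
  shows "inj_on L (carrier_vec n)"
proof (rule inj_onI)
  fix u v assume uv: "u \<in> carrier_vec n" "v \<in> carrier_vec n" "L u = L v"
  have L: "L u \<in> carrier_vec d" "L v \<in> carrier_vec d"
    using assms(1) uv by (auto simp: linear_maps_def)
  have "L (u + (- 1) \<cdot>\<^sub>v v) = L u + (- 1) \<cdot>\<^sub>v L v"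
    using assms(1) uv by (simp add: linear_maps_def)
  also have "\<dots> = 0\<^sub>v d" unfolding uv(3) by (rule eq_vecI) (use L in auto)
  finally have z: "u + (- 1) \<cdot>\<^sub>v v = 0\<^sub>v n" using assms(2) uv by simp
  show "u = v"
  proof (rule eq_vecI)
    fix i assume "i < dim_vec v"
    then have "(u + (- 1) \<cdot>\<^sub>v v) $ i = 0" using z uv by simp
    then show "u $ i = v $ i" using uv \<open>i < dim_vec v\<close> by simp
  qed (use uv in auto)
qed

lemma bivariate_form_line:
  assumes G: "\<And>c. G (c \<cdot>\<^sub>v x) = c ^ k * G x"
  shows "bivariate {k} (\<lambda>s t. G ((s * a + t * b) \<cdot>\<^sub>v x))"
proof -
  have "bivariate {k} (\<lambda>s t. (s * a + t * b) ^ k * G x)"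
    by (rule bivariate_mult[OF bivariate_power[OF bivariate_linear[of "{1}"]] bivariate_const[of "{0}"]]) auto
  then show ?thesis by (simp add: G)
qed

text \<open>Embeddings only see independent pairs. For a dependent pair both vectors are multiples
  of one of them, and homogeneity alone gives the form.\<close>

lemma planewise_formI:
  fixes G :: "'a::field vec \<Rightarrow> 'a"
  assumes smult: "\<And>c x. x \<in> carrier_vec n \<Longrightarrow> G (c \<cdot>\<^sub>v x) = c ^ k * G x"
    and inj: "\<And>x y. x \<in> carrier_vec n \<Longrightarrow> y \<in> carrier_vec n \<Longrightarrow>
      inj_on (plane_map x y) (carrier_vec 2) \<Longrightarrow> bivariate {k} (\<lambda>s t. G (s \<cdot>\<^sub>v x + t \<cdot>\<^sub>v y))"
  shows "planewise_form n k G"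
  unfolding planewise_form_def
proof (intro ballI)
  fix x y :: "'a vec" assume xy: "x \<in> carrier_vec n" "y \<in> carrier_vec n"
  show "bivariate {k} (\<lambda>s t. G (s \<cdot>\<^sub>v x + t \<cdot>\<^sub>v y))"
  proof (cases "inj_on (plane_map x y) (carrier_vec 2)")
    case False
    then obtain z where z: "z \<in> carrier_vec 2" "z \<noteq> 0\<^sub>v 2" "plane_map x y z = 0\<^sub>v n"
      using inj_on_linear_map[OF plane_map_linear[OF xy]] by blast
    have dep: "z $ 0 * x $ i + z $ 1 * y $ i = 0" if "i < n" for i
    proof -
      have "(z $ 0 \<cdot>\<^sub>v x + z $ 1 \<cdot>\<^sub>v y) $ i = 0"
        using z(1,3) that by (simp add: plane_map_def)
      then show ?thesis using that xy by simp
    qed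
    have "z $ 0 \<noteq> 0 \<or> z $ 1 \<noteq> 0"
    proof (rule ccontr)
      assume "\<not> ?thesis"
      then have "z = 0\<^sub>v 2"
        using z(1) by (intro eq_vecI) (auto simp: less_2_cases_iff)
      then show False using z(2) by simp
    qed
    then show ?thesis
    proof
      \<comment> \<open>A kernel vector with nonzero first entry makes \<open>x\<close> a multiple
        of \<open>y\<close>; the other case is symmetric.\<close>
      assume nz: "z $ 0 \<noteq> 0"
      have "s \<cdot>\<^sub>v x + t \<cdot>\<^sub>v y = (s * (- z $ 1 / z $ 0) + t * 1) \<cdot>\<^sub>v y" for s t
      proof (rule eq_vecI)
        fix i assume "i < dim_vec ((s * (- z $ 1 / z $ 0) + t * 1) \<cdot>\<^sub>v y)"
        then have i: "i < n" using xy by simp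
        then have "x $ i = - z $ 1 / z $ 0 * y $ i"
          using dep[OF i] nz by (simp add: field_simps eq_neg_iff_add_eq_0)
        then show "(s \<cdot>\<^sub>v x + t \<cdot>\<^sub>v y) $ i = ((s * (- z $ 1 / z $ 0) + t * 1) \<cdot>\<^sub>v y) $ i"
          using i xy by (simp add: algebra_simps)
      qed (use xy in simp)
      then show ?thesis by (simp only: bivariate_form_line[OF smult[OF xy(2)]])
    next
      assume nz: "z $ 1 \<noteq> 0"
      have "s \<cdot>\<^sub>v x + t \<cdot>\<^sub>v y = (s * 1 + t * (- z $ 0 / z $ 1)) \<cdot>\<^sub>v x" for s t
      proof (rule eq_vecI)
        fix i assume "i < dim_vec ((s * 1 + t * (- z $ 0 / z $ 1)) \<cdot>\<^sub>v x)"
        then have i: "i < n" using xy by simp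
        then have "y $ i = - z $ 0 / z $ 1 * x $ i"
          using dep[OF i] nz by (simp add: field_simps eq_neg_iff_add_eq_0 add.commute)
        then show "(s \<cdot>\<^sub>v x + t \<cdot>\<^sub>v y) $ i = ((s * 1 + t * (- z $ 0 / z $ 1)) \<cdot>\<^sub>v x) $ i"
          using i xy by (simp add: algebra_simps)
      qed (use xy in simp)
      then show ?thesis by (simp only: bivariate_form_line[OF smult[OF xy(1)]])
    qed
  qed (use inj xy in blast)
qed

section \<open>The two lifted codes described by functions\<close>

lemma PLift_iff:
  fixes c :: "'a::{field,finite} vec set \<Rightarrow> 'a"
  assumes "0 < n" "0 < k"
  shows "c \<in> PLift n k \<longleftrightarrow>
    (\<exists>G. planewise_form (Suc n) k G \<and> c = (\<lambda>P\<in>proj_space n. G (standard_rep P)))"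
proof
  assume "c \<in> PLift n k"
  then obtain f where c: "c = ev_proj n f"
    and f: "f \<in> homogeneous_polys (Suc n) (k + (n - 1) * (CARD('a) - 1))"
    and L: "\<And>L. L \<in> emb_proj n \<Longrightarrow> ev_proj 1 (compose_proj f L) \<in> PRS k"
    unfolding PLift_def by blast
  \<comment> \<open>The degree of \<open>f\<close> exceeds \<open>k\<close> by a multiple of q - 1,
    so \<open>f\<close> scales like a form of degree \<open>k\<close>; \<open>0 < k\<close> covers
    the scalar 0.\<close>
  have smult: "eval_mpoly (a \<cdot>\<^sub>v x) f = a ^ k * eval_mpoly x f" if "x \<in> carrier_vec (Suc n)" for a x
    using eval_mpoly_smult[OF f that, of a] finite_field_power_add_card[OF assms(2)] by metis
  have "planewise_form (Suc n) k (\<lambda>x. eval_mpoly x f)"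
  proof (rule planewise_formI[OF smult])
    fix x y :: "'a vec"
    assume xy: "x \<in> carrier_vec (Suc n)" "y \<in> carrier_vec (Suc n)"
      and inj: "inj_on (plane_map x y) (carrier_vec 2)"
    have eval: "eval_mpoly z (compose_proj f (plane_map x y)) = eval_mpoly (z $ 0 \<cdot>\<^sub>v x + z $ 1 \<cdot>\<^sub>v y) f" for z
      using eval_mpoly_compose_proj[OF homogeneous_polys_in_polys[OF f], of "plane_map x y" z]
      by (simp only: plane_map_unit_vec[OF xy] xy)
    have "plane_map x y \<in> emb_proj n"
      using inj plane_map_linear[OF xy] by (simp add: emb_proj_def)
    from L[OF this] obtain g where g: "g \<in> homogeneous_polys 2 k"
      and ev: "ev_proj 1 (compose_proj f (plane_map x y)) = ev_proj 1 g"
      unfolding PRS_def by blast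
    \<comment> \<open>Membership in \<open>PRS\<close> compares values only at standard
      representatives; equal scaling behaviour spreads the equality to all vectors.\<close>
    have "eval_mpoly z (compose_proj f (plane_map x y)) = eval_mpoly z g" if "z \<in> carrier_vec (Suc 1)" for z
    proof (rule eq_if_eq_on_standard_reps[of 1 _ k, OF _ _ assms(2) _ that])
      fix a and z :: "'a vec" assume z: "z \<in> carrier_vec (Suc 1)"
      show "eval_mpoly (a \<cdot>\<^sub>v z) g = a ^ k * eval_mpoly z g"
        using eval_mpoly_smult[OF g] z by (simp add: numeral_2_eq_2)
      have "(a \<cdot>\<^sub>v z) $ 0 \<cdot>\<^sub>v x + (a \<cdot>\<^sub>v z) $ 1 \<cdot>\<^sub>v y = a \<cdot>\<^sub>v (z $ 0 \<cdot>\<^sub>v x + z $ 1 \<cdot>\<^sub>v y)"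
        by (rule eq_vecI) (use xy z in \<open>auto simp: algebra_simps\<close>)
      then show "eval_mpoly (a \<cdot>\<^sub>v z) (compose_proj f (plane_map x y)) =
          a ^ k * eval_mpoly z (compose_proj f (plane_map x y))"
        unfolding eval using smult[of "z $ 0 \<cdot>\<^sub>v x + z $ 1 \<cdot>\<^sub>v y" a] xy by simp
    next
      fix P :: "'a vec set" assume "P \<in> proj_space 1"
      then show "eval_mpoly (standard_rep P) (compose_proj f (plane_map x y)) = eval_mpoly (standard_rep P) g"
        using fun_cong[OF ev, of P] by (simp add: ev_proj_def)
    qed
    from this[of "vec 2 (\<lambda>i. if i = 0 then s else t)" for s t]
    have "eval_mpoly (vec 2 (\<lambda>i. if i = 0 then s else t)) g = eval_mpoly (s \<cdot>\<^sub>v x + t \<cdot>\<^sub>v y) f" for s t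
      unfolding eval by (simp add: numeral_2_eq_2)
    then show "bivariate {k} (\<lambda>s t. eval_mpoly (s \<cdot>\<^sub>v x + t \<cdot>\<^sub>v y) f)"
      using homogeneous_poly_imp_bivariate[OF g] by simp
  qed
  then show "\<exists>G. planewise_form (Suc n) k G \<and> c = (\<lambda>P\<in>proj_space n. G (standard_rep P))"
    using c unfolding ev_proj_def by blast
next
  assume "\<exists>G. planewise_form (Suc n) k G \<and> c = (\<lambda>P\<in>proj_space n. G (standard_rep P))"
  then obtain G where G: "planewise_form (Suc n) k G" and c: "c = (\<lambda>P\<in>proj_space n. G (standard_rep P))"
    by blast
  obtain f where f: "f \<in> homogeneous_polys (Suc n) (k + (n - 1) * (CARD('a) - 1))"
    and fG: "\<And>x. x \<in> carrier_vec (Suc n) \<Longrightarrow> eval_mpoly x f = G x"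
    using planewise_form_imp_homogeneous_poly[OF G assms] by blast
  have "ev_proj 1 (compose_proj f L) \<in> PRS k" if "L \<in> emb_proj n" for L
  proof -
    let ?x = "L (unit_vec 2 0)" and ?y = "L (unit_vec 2 1)"
    have xy: "?x \<in> carrier_vec (Suc n)" "?y \<in> carrier_vec (Suc n)"
      using that linear_maps_2_unit_vec by (auto simp: emb_proj_def)
    obtain g where g: "g \<in> homogeneous_polys 2 k"
      "\<And>z. eval_mpoly z g = G (z $ 0 \<cdot>\<^sub>v ?x + z $ 1 \<cdot>\<^sub>v ?y)"
      using bivariate_imp_homogeneous_poly[OF planewise_formD[OF G xy]] by blast
    have "ev_proj 1 (compose_proj f L) = ev_proj 1 g"
      unfolding ev_proj_def eval_mpoly_compose_proj[OF homogeneous_polys_in_polys[OF f] xy] g(2)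
      using xy by (intro restrict_ext fG) auto
    then show ?thesis using g(1) unfolding PRS_def by blast
  qed
  moreover have "c = ev_proj n f"
    unfolding c ev_proj_def by (intro restrict_ext) (simp add: standard_rep(2) fG)
  ultimately show "c \<in> PLift n k" using f unfolding PLift_def by blast
qed

lemma Lift_iff:
  fixes h :: "'a::{field,finite} vec \<Rightarrow> 'a"
  shows "h \<in> Lift m k \<longleftrightarrow> h \<in> extensional (carrier_vec m) \<and>
    (\<forall>a\<in>carrier_vec m. \<forall>b\<in>carrier_vec m. \<exists>p. degree p \<le> k \<and> (\<forall>t. h (a + t \<cdot>\<^sub>v b) = poly p t))"
proof (intro iffI conjI ballI)
  assume "h \<in> Lift m k"
  then obtain f where h: "h = ev_aff m f" and f: "f \<in> polys m"
    and L: "\<And>L. L \<in> emb_aff m \<Longrightarrow> poly (compose_aff f L) \<in> RS k"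
    unfolding Lift_def by blast
  show "h \<in> extensional (carrier_vec m)" by (simp add: h ev_aff_def)
  fix a b :: "'a vec" assume ab: "a \<in> carrier_vec m" "b \<in> carrier_vec m"
  show "\<exists>p. degree p \<le> k \<and> (\<forall>t. h (a + t \<cdot>\<^sub>v b) = poly p t)"
  proof (cases "b = 0\<^sub>v m")
    case True
    then show ?thesis using ab by (intro exI[of _ "[:h a:]"]) simp
  next
    case False
    let ?L = "plane_map (vCons 1 a) (vCons 0 b)"
    have lin: "?L \<in> linear_maps 2 (Suc m)" using ab by (intro plane_map_linear) simp_all
    have "inj_on ?L (carrier_vec 2)"
    proof (rule inj_on_linear_map[OF lin])
      fix z :: "'a vec" assume z: "z \<in> carrier_vec 2" "?L z = 0\<^sub>v (Suc m)"
      have "?L z = vCons (z $ 0) (z $ 0 \<cdot>\<^sub>v a + z $ 1 \<cdot>\<^sub>v b)"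
        using ab z(1) by (simp add: plane_map_def)
      then have "vCons (z $ 0) (z $ 0 \<cdot>\<^sub>v a + z $ 1 \<cdot>\<^sub>v b) = vCons 0 (0\<^sub>v m)"
        using z(2) by (simp only: zero_vec_Suc)
      then have z0: "z $ 0 = 0" and "z $ 0 \<cdot>\<^sub>v a + z $ 1 \<cdot>\<^sub>v b = 0\<^sub>v m"
        unfolding vCons_eq_vCons by blast+
      then have z1: "z $ 1 \<cdot>\<^sub>v b = 0\<^sub>v m" using ab by simp
      have "z $ 1 = 0"
      proof (rule ccontr)
        assume "z $ 1 \<noteq> 0"
        then have "b = inverse (z $ 1) \<cdot>\<^sub>v (z $ 1 \<cdot>\<^sub>v b)" by (simp add: smult_smult_assoc)
        then show False using z1 False by simp
      qed
      then show "z = 0\<^sub>v 2"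
        using z0 z(1) by (intro eq_vecI) (auto simp: less_2_cases_iff)
    qed
    \<comment> \<open>The component \<open>L0\<close> demanded by \<open>emb_aff\<close> is the
      first parameter, which makes the extended map the plane map of (1, a) and (0, b).\<close>
    moreover have "(\<lambda>z\<in>carrier_vec 2. vCons (z $ 0) (plane_map a b z)) = ?L"
      unfolding plane_map_def by (rule restrict_ext) (use ab in simp)
    ultimately have "plane_map a b \<in> emb_aff m"
      using lin plane_map_linear[OF ab] unfolding emb_aff_def emb_proj_def
      by (intro CollectI conjI exI[of _ "\<lambda>z. z $ 0"]) simp_all
    then obtain g where g: "degree g \<le> k" "poly (compose_aff f (plane_map a b)) = poly g"
      using L unfolding RS_def by blast
    have "h (a + t \<cdot>\<^sub>v b) = poly g t" for t
      using poly_compose_aff[OF f, of "plane_map a b" t] ab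
      by (simp add: plane_map_unit_vec[OF ab] plane_map_unit_vec(2)[OF ab, simplified] h ev_aff_def flip: g(2))
    then show ?thesis using g(1) by blast
  qed
next
  assume *: "h \<in> extensional (carrier_vec m) \<and>
    (\<forall>a\<in>carrier_vec m. \<forall>b\<in>carrier_vec m. \<exists>p. degree p \<le> k \<and> (\<forall>t. h (a + t \<cdot>\<^sub>v b) = poly p t))"
  obtain f where f: "f \<in> polys m" "\<And>x. x \<in> carrier_vec m \<Longrightarrow> eval_mpoly x f = h x"
    using obtain_polynomial by blast
  have "poly (compose_aff f L) \<in> RS k" if "L \<in> emb_aff m" for L
  proof -
    let ?a = "L (unit_vec 2 0)" and ?b = "L (unit_vec 2 1)"
    have ab: "?a \<in> carrier_vec m" "?b \<in> carrier_vec m"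
      using that linear_maps_2_unit_vec by (auto simp: emb_aff_def)
    then obtain p where p: "degree p \<le> k" "\<And>t. h (?a + t \<cdot>\<^sub>v ?b) = poly p t" using * by blast
    have "poly (compose_aff f L) t = poly p t" for t
      unfolding poly_compose_aff[OF f(1) ab] using f(2)[of "?a + t \<cdot>\<^sub>v ?b"] ab p(2) by simp
    then show ?thesis using p(1) unfolding RS_def by blast
  qed
  moreover have "h = ev_aff m f"
    using * f(2) by (auto simp: ev_aff_def extensional_def fun_eq_iff)
  ultimately show "h \<in> Lift m k" using f(1) unfolding Lift_def by blast
qed

section \<open>Shortening and puncturing at infinity\<close>

definition vec_tail :: "'a vec \<Rightarrow> 'a vec" where
  "vec_tail v = vec (dim_vec v - 1) (\<lambda>i. v $ Suc i)"

lemma vec_tail_vCons [simp]: "vec_tail (vCons a v) = v"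
  by (rule eq_vecI) (auto simp: vec_tail_def)

lemma carrier_vec_SucE:
  assumes "v \<in> carrier_vec (Suc n)"
  obtains a w where "v = vCons a w" "w \<in> carrier_vec n"
  using assms by (cases v) auto

text \<open>Since the degree is strictly below \<open>k\<close>, every term keeps a positive power
  of \<open>u\<close>, so the form really takes the value 0 prescribed at
  \<open>u = 0\<close>.\<close>

lemma bivariate_homogenization:
  fixes p :: "'a::field poly"
  assumes "degree p < k"
  shows "bivariate {k} (\<lambda>u t. if u = 0 then 0 else u ^ k * poly p (t / u))"
proof -
  have "(if u = 0 then 0 else u ^ k * poly p (t / u)) =
      (\<Sum>i\<le>degree p. coeff p i * u ^ (k - i) * t ^ i)" for u t
  proof (cases "u = 0")
    case False
    have "u ^ k * (coeff p i * (t / u) ^ i) = coeff p i * u ^ (k - i) * t ^ i" if "i \<le> degree p" for i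
    proof -
      have "u ^ k = u ^ (k - i) * u ^ i" using that assms by (simp flip: power_add)
      then show ?thesis using False by (simp add: power_divide)
    qed
    then have "u ^ k * poly p (t / u) = (\<Sum>i\<le>degree p. coeff p i * u ^ (k - i) * t ^ i)"
      unfolding poly_altdef sum_distrib_left by (intro sum.cong) simp_all
    then show ?thesis using False by simp
  qed (use assms in \<open>simp add: power_0_left\<close>)
  moreover have "bivariate {k} (\<lambda>u t. \<Sum>i\<le>degree p. coeff p i * u ^ (k - i) * t ^ i)"
    by (rule bivariate_sum, rule bivariate.monomial) (use assms in auto)
  ultimately show ?thesis by simp
qed

definition extend_by_zero :: "nat \<Rightarrow> ('a::field vec \<Rightarrow> 'a) \<Rightarrow> 'a vec \<Rightarrow> 'a" where
  "extend_by_zero k h v =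
     (if v $ 0 = 0 then 0 else (v $ 0) ^ k * h (inverse (v $ 0) \<cdot>\<^sub>v vec_tail v))"

text \<open>A plane not contained in x_0 = 0 has a spanning pair (1, a), (0, b), for which the
  function is the homogenisation of \<open>h\<close> on an affine line. A linear change of
  parameters reaches every other spanning pair.\<close>

lemma planewise_form_extend_by_zero:
  fixes h :: "'a::field vec \<Rightarrow> 'a"
  assumes "0 < k"
    and h: "\<And>a b. a \<in> carrier_vec m \<Longrightarrow> b \<in> carrier_vec m \<Longrightarrow>
      \<exists>p. degree p \<le> k - 1 \<and> (\<forall>t. h (a + t \<cdot>\<^sub>v b) = poly p t)"
  shows "planewise_form (Suc m) k (extend_by_zero k h)"
  unfolding planewise_form_def
proof (intro ballI)
  let ?G = "extend_by_zero k h"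
  fix x y :: "'a vec" assume "x \<in> carrier_vec (Suc m)" "y \<in> carrier_vec (Suc m)"
  then obtain x0 x' y0 y' where x: "x = vCons x0 x'" "x' \<in> carrier_vec m"
    and y: "y = vCons y0 y'" "y' \<in> carrier_vec m"
    by (elim carrier_vec_SucE)
  have xy: "s \<cdot>\<^sub>v x + t \<cdot>\<^sub>v y = vCons (s * x0 + t * y0) (s \<cdot>\<^sub>v x' + t \<cdot>\<^sub>v y')" for s t
    using x y by simp
  have basic: "bivariate {k} (\<lambda>u t. ?G (vCons u (u \<cdot>\<^sub>v a + t \<cdot>\<^sub>v b)))"
    if ab: "a \<in> carrier_vec m" "b \<in> carrier_vec m" for a b
  proof -
    obtain p where p: "degree p \<le> k - 1" "\<And>t. h (a + t \<cdot>\<^sub>v b) = poly p t"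
      using h[OF ab] by blast
    have "inverse u \<cdot>\<^sub>v (u \<cdot>\<^sub>v a + t \<cdot>\<^sub>v b) = a + (t / u) \<cdot>\<^sub>v b" if "u \<noteq> 0" for u t
      by (rule eq_vecI) (use ab that in \<open>auto simp: field_simps\<close>)
    then have "?G (vCons u (u \<cdot>\<^sub>v a + t \<cdot>\<^sub>v b)) = (if u = 0 then 0 else u ^ k * poly p (t / u))" for u t
      by (simp add: extend_by_zero_def p(2))
    then show ?thesis using bivariate_homogenization[of p k] p(1) assms(1) by simp
  qed
  have lin: "bivariate {1} (\<lambda>s t. s * x0 + t * y0)" by (rule bivariate_linear) simp
  consider "x0 \<noteq> 0" | "y0 \<noteq> 0" | "x0 = 0" "y0 = 0" by blast
  then show "bivariate {k} (\<lambda>s t. ?G (s \<cdot>\<^sub>v x + t \<cdot>\<^sub>v y))"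
  proof cases
    case 1
    \<comment> \<open>The new pair is \<open>x\<close> divided by x0, and \<open>y\<close> with its
      leading coordinate eliminated by \<open>x\<close>; the new parameters are s * x0 + t * y0 and
      t.\<close>
    have "s \<cdot>\<^sub>v x' + t \<cdot>\<^sub>v y' = (s * x0 + t * y0) \<cdot>\<^sub>v (inverse x0 \<cdot>\<^sub>v x') +
        t \<cdot>\<^sub>v (y' + (- y0 / x0) \<cdot>\<^sub>v x')" for s t
      by (rule eq_vecI) (use 1 x y in \<open>auto simp: field_simps\<close>)
    moreover have "bivariate {1} (\<lambda>s t::'a. t)" using bivariate_linear[of "{1}" 0 1] by simp
    ultimately show ?thesis
      unfolding xy
      using bivariate_subst[OF basic[of "inverse x0 \<cdot>\<^sub>v x'" "y' + (- y0 / x0) \<cdot>\<^sub>v x'"] lin] x y by simp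
  next
    case 2
    have "s \<cdot>\<^sub>v x' + t \<cdot>\<^sub>v y' = (s * x0 + t * y0) \<cdot>\<^sub>v (inverse y0 \<cdot>\<^sub>v y') +
        s \<cdot>\<^sub>v (x' + (- x0 / y0) \<cdot>\<^sub>v y')" for s t
      by (rule eq_vecI) (use 2 x y in \<open>auto simp: field_simps\<close>)
    moreover have "bivariate {1} (\<lambda>s t::'a. s)" using bivariate_linear[of "{1}" 1 0] by simp
    ultimately show ?thesis
      unfolding xy
      using bivariate_subst[OF basic[of "inverse y0 \<cdot>\<^sub>v y'" "x' + (- x0 / y0) \<cdot>\<^sub>v y'"] lin] x y by simp
  next
    case 3
    then have "?G (s \<cdot>\<^sub>v x + t \<cdot>\<^sub>v y) = 0" for s t by (simp add: xy extend_by_zero_def)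
    then show ?thesis using bivariate.zero by simp
  qed
qed

text \<open>Vanishing at infinity kills the coefficient of degree \<open>k\<close> on every affine
  line. Conversely, \<open>extend_by_zero\<close> supplies a codeword that vanishes at infinity and
  restricts to the given one.\<close>

lemma shortening_eq_Lift:
  assumes "0 < m" "0 < k"
  shows "{restrict_aff m c |c. c \<in> PLift m k \<and> (\<forall>P \<in> hyperplane_at_infinity m. c P = 0)}
    = (Lift m (k - 1) :: ('a::{field,finite} vec \<Rightarrow> 'a) set)"
proof (intro equalityI subsetI)
  have restrict: "restrict_aff m (\<lambda>P\<in>proj_space m. G (standard_rep P)) = (\<lambda>a\<in>carrier_vec m. G (vCons 1 a))"
    for G :: "'a vec \<Rightarrow> 'a"
    unfolding restrict_aff_def by (rule restrict_ext) (simp add: standard_rep_affine_point)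
  {
    fix h :: "'a vec \<Rightarrow> 'a"
    assume "h \<in> {restrict_aff m c |c. c \<in> PLift m k \<and> (\<forall>P \<in> hyperplane_at_infinity m. c P = 0)}"
    then obtain G where G: "planewise_form (Suc m) k G"
      and vanish: "\<And>P. P \<in> hyperplane_at_infinity m \<Longrightarrow> (\<lambda>P\<in>proj_space m. G (standard_rep P)) P = 0"
      and h: "h = (\<lambda>a\<in>carrier_vec m. G (vCons 1 a))"
      unfolding PLift_iff[OF assms] using restrict by blast
    \<comment> \<open>The codeword records \<open>G\<close> only at standard representatives;
      homogeneity transfers the zeros to every vector with leading coordinate 0.\<close>
    have G0: "G (vCons 0 b) = 0" if b: "b \<in> carrier_vec m" for b
    proof (cases "b = 0\<^sub>v m")
      case True
      then show ?thesis using planewise_form_zero[OF G assms(2)] by (simp add: zero_vec_Suc)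
    next
      case False
      let ?x = "vCons 0 b" and ?P = "proj_rel m `` {vCons 0 b}"
      have x: "?x \<in> carrier_vec (Suc m)" "?x \<noteq> 0\<^sub>v (Suc m)"
        using b False by (simp_all add: zero_vec_Suc)
      then obtain c where c: "c \<noteq> 0" "standard_rep ?P = c \<cdot>\<^sub>v ?x"
        using standard_rep_proj_rel_Image by blast
      have P: "?P \<in> proj_space m" by (rule proj_spaceI[OF x])
      have "\<forall>z\<in>?P. z $ 0 = 0" unfolding proj_rel_Image[OF x] by auto
      then have "?P \<in> hyperplane_at_infinity m" using P unfolding hyperplane_at_infinity_def by blast
      from vanish[OF this] have "G (c \<cdot>\<^sub>v ?x) = 0" using P c(2) by simp
      then show ?thesis using planewise_form_smult[OF G x(1), of c] c(1) by simp
    qed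
    have "\<exists>p. degree p \<le> k - 1 \<and> (\<forall>t. h (a + t \<cdot>\<^sub>v b) = poly p t)"
      if ab: "a \<in> carrier_vec m" "b \<in> carrier_vec m" for a b
    proof -
      have "bivariate {k} (\<lambda>s t. G (s \<cdot>\<^sub>v vCons 1 a + t \<cdot>\<^sub>v vCons 0 b))"
        by (rule planewise_formD[OF G]) (use ab in simp_all)
      from bivariate_form_dehomogenize[OF this]
      obtain p where p: "degree p \<le> k" "\<And>t. G (1 \<cdot>\<^sub>v vCons 1 a + t \<cdot>\<^sub>v vCons 0 b) = poly p t"
        "G (0 \<cdot>\<^sub>v vCons 1 a + 1 \<cdot>\<^sub>v vCons 0 b) = coeff p k" by blast
      \<comment> \<open>The top coefficient is the value of \<open>G\<close> at the direction (0, b)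
        of the line, a vector at infinity.\<close>
      have "coeff p k = 0" using p(3) G0[OF ab(2)] ab by (simp flip: p(3))
      then have "degree p \<le> k - 1"
        using p(1) assms(2) by (metis One_nat_def Suc_pred coeff_0 degree_0 leading_coeff_0_iff le_SucE le0)
      moreover have "h (a + t \<cdot>\<^sub>v b) = poly p t" for t
        using p(2)[of t] ab by (simp add: h)
      ultimately show ?thesis by blast
    qed
    then show "h \<in> Lift m (k - 1)" by (simp add: Lift_iff h)
  next
    fix h :: "'a vec \<Rightarrow> 'a" assume h: "h \<in> Lift m (k - 1)"
    let ?c = "\<lambda>P\<in>proj_space m. extend_by_zero k h (standard_rep P)"
    have "?c \<in> PLift m k"
      unfolding PLift_iff[OF assms] using planewise_form_extend_by_zero[OF assms(2)] h
      unfolding Lift_iff by blast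
    moreover have "?c P = 0" if "P \<in> hyperplane_at_infinity m" for P
      using that standard_rep(1)[of P m] by (simp add: hyperplane_at_infinity_def extend_by_zero_def)
    moreover have "restrict_aff m ?c = h"
      unfolding restrict using h[unfolded Lift_iff]
      by (auto simp: extend_by_zero_def extensional_def fun_eq_iff)
    ultimately show "h \<in> {restrict_aff m c |c. c \<in> PLift m k \<and> (\<forall>P \<in> hyperplane_at_infinity m. c P = 0)}"
      by (intro CollectI exI[of _ ?c] conjI ballI) simp_all
  }
qed

text \<open>Prepending 0 and deleting the leading coordinate are both linear, so composing with
  either preserves planewise forms.\<close>

lemma puncturing_eq_PLift:
  assumes "0 < n" "0 < k"
  shows "{restrict_inf (Suc n) c |c. c \<in> PLift (Suc n) k} =
    (PLift n k :: ('a::{field,finite} vec set \<Rightarrow> 'a) set)"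
proof (intro equalityI subsetI)
  have restrict: "restrict_inf (Suc n) (\<lambda>P\<in>proj_space (Suc n). G (standard_rep P)) =
      (\<lambda>Q\<in>proj_space n. G (vCons 0 (standard_rep Q)))" for G :: "'a vec \<Rightarrow> 'a"
    unfolding restrict_inf_def diff_Suc_1 by (rule restrict_ext) (simp add: standard_rep_at_infinity)
  {
    fix d :: "'a vec set \<Rightarrow> 'a"
    assume "d \<in> {restrict_inf (Suc n) c |c. c \<in> PLift (Suc n) k}"
    then obtain G where G: "planewise_form (Suc (Suc n)) k G"
      and d: "d = (\<lambda>Q\<in>proj_space n. G (vCons 0 (standard_rep Q)))"
      unfolding PLift_iff[OF zero_less_Suc assms(2)] using restrict by blast
    have "planewise_form (Suc n) k (\<lambda>x. G (vCons 0 x))"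
      unfolding planewise_form_def
    proof (intro ballI)
      fix x y :: "'a vec" assume "x \<in> carrier_vec (Suc n)" "y \<in> carrier_vec (Suc n)"
      then show "bivariate {k} (\<lambda>s t. G (vCons 0 (s \<cdot>\<^sub>v x + t \<cdot>\<^sub>v y)))"
        using planewise_formD[OF G, of "vCons 0 x" "vCons 0 y"] by simp
    qed
    then show "d \<in> PLift n k" unfolding PLift_iff[OF assms] d by blast
  next
    fix d :: "'a vec set \<Rightarrow> 'a" assume "d \<in> PLift n k"
    then obtain G where G: "planewise_form (Suc n) k G"
      and d: "d = (\<lambda>Q\<in>proj_space n. G (standard_rep Q))"
      unfolding PLift_iff[OF assms] by blast
    \<comment> \<open>The preimage is the cone over \<open>G\<close>, constant in x_0. Deleting x_0
      may collapse a plane, which \<open>planewise_form\<close> allows.\<close>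
    have "planewise_form (Suc (Suc n)) k (\<lambda>x. G (vec_tail x))"
      unfolding planewise_form_def
    proof (intro ballI)
      fix x y :: "'a vec" assume "x \<in> carrier_vec (Suc (Suc n))" "y \<in> carrier_vec (Suc (Suc n))"
      then obtain x0 x' y0 y' where "x = vCons x0 x'" "x' \<in> carrier_vec (Suc n)"
        "y = vCons y0 y'" "y' \<in> carrier_vec (Suc n)"
        by (metis carrier_vec_SucE)
      then show "bivariate {k} (\<lambda>s t. G (vec_tail (s \<cdot>\<^sub>v x + t \<cdot>\<^sub>v y)))"
        using planewise_formD[OF G, of x' y'] by simp
    qed
    then have "(\<lambda>P\<in>proj_space (Suc n). G (vec_tail (standard_rep P))) \<in> PLift (Suc n) k"
      unfolding PLift_iff[OF zero_less_Suc assms(2)] by blast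
    moreover have "d = restrict_inf (Suc n) (\<lambda>P\<in>proj_space (Suc n). G (vec_tail (standard_rep P)))"
      using restrict[of "\<lambda>x. G (vec_tail x)"] by (simp add: d)
    ultimately show "d \<in> {restrict_inf (Suc n) c |c. c \<in> PLift (Suc n) k}" by blast
  }
qed

theorem theorem39:
  fixes m k :: nat
  assumes "1 \<le> m" and "1 \<le> k" and "k \<le> CARD('a::{field,finite}) - 1"
  shows "{restrict_aff m c |c. c \<in> PLift m k \<and> (\<forall>P \<in> hyperplane_at_infinity m. c P = 0)}
           = (Lift m (k - 1) :: ('a vec \<Rightarrow> 'a) set) \<and>
         (2 \<le> m \<longrightarrow>
           {restrict_inf m c |c. c \<in> PLift m k} = (PLift (m - 1) k :: ('a vec set \<Rightarrow> 'a) set))"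
proof (intro conjI impI)
  show "{restrict_aff m c |c. c \<in> PLift m k \<and> (\<forall>P \<in> hyperplane_at_infinity m. c P = 0)}
      = (Lift m (k - 1) :: ('a vec \<Rightarrow> 'a) set)"
    using assms by (intro shortening_eq_Lift) auto
  assume "2 \<le> m"
  then show "{restrict_inf m c |c. c \<in> PLift m k} = (PLift (m - 1) k :: ('a vec set \<Rightarrow> 'a) set)"
    using puncturing_eq_PLift[of "m - 1" k, where 'a='a] assms(2) by simp
qed

end
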